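(* Let $K$ be an infinite field, $P=K[x_1,\dots,x_n]$, let $\mathcal{L}$ be a distraction matrix with entries in $P_1$, and let $M$ be an $\mathbb{I}$-graded submodule of a finitely generated $\mathbb{I}$-graded free module $\bigoplus_{i=1}^rP(-t_i)$. Then the standard Betti numbers of $M$ and of $D_{\mathcal{L}}(M)$ are the same.
   Context: A distraction matrix is an infinite matrix $\mathcal{L}=(L_{ij}\mid i=1,\dots,n,\ j\ge 1)$ with $L_{ij}\in P_1$ (linear forms) such that (i) $\langle L_{1j_1},\dots,L_{nj_n}\rangle=P_1$ ($K$-linear span) for all $j_1,\dots,j_n\ge 1$; (ii) there is $N$ with $L_{ij}=L_{iN}$ for all $i$ and all $j>N$. For a power product $t=x_1^{\alpha_1}\cdots x_n^{\alpha_n}$ put $D_{\mathcal{L}}(t)=\prod_{i=1}^n\prod_{j=1}^{\alpha_i}L_{ij}$ and extend $D_{\mathcal{L}}$ to $P$ by $K$-linearity. If $t_1\mid t_2$ then $D_{\mathcal{L}}(t_1)\mid D_{\mathcal{L}}(t_2)$. $\mathbb{I}$-graded means $\mathbb{Z}^n$-graded with respect to the fine grading $\deg(x_i)=$ the $i$-th standard basis vector; multidegrees $\log(t)$ are identified with power products $t$, and $P(-t)$ is the $\mathbb{I}$-graded free module on a generator of multidegree $t$. $P(-d)$ is the standard graded free module on a generator of degree $d$. For $\bigoplus_{i=1}^rP(-t_i)$ with basis $e_1,\dots,e_r$ and $d_i=\deg(t_i)$, the map $D_{\mathcal{L}}:\bigoplus_iP(-t_i)\to\bigoplus_iP(-d_i)$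 is the $K$-linear map with $t\,e_i\mapsto \frac{D_{\mathcal{L}}(t\,t_i)}{D_{\mathcal{L}}(t_i)}\,e_i$ for every power product $t$. The image $D_{\mathcal{L}}(M)$ of an $\mathbb{I}$-graded submodule $M$ is a standard graded $P$-submodule of $\bigoplus_iP(-d_i)$. Standard Betti numbers are the graded Betti numbers with respect to the standard grading, $\beta_{k,d}(M)=\dim_K\mathrm{Tor}_k^P(M,K)_d$, where $M$ is viewed as standard graded by total degree with $\deg e_i=d_i$. *)

theory Defs
  imports Complex_Main "HOL-Library.Poly_Mapping"
begin

section \<open>Polynomials and free modules\<close>

text \<open>
  The variables are the elements of a finite type \<open>'n\<close>. A power product is its exponent
  vector (so products of power products are sums), and a polynomial is a finitely supported
  family of coefficients indexed by power products.
\<close>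

type_synonym 'n pp = "'n \<Rightarrow>\<^sub>0 nat"
type_synonym ('n, 'k) mpoly = "'n pp \<Rightarrow>\<^sub>0 'k"

text \<open>
  Elements of free modules with basis \<open>e\<^sub>0, e\<^sub>1, \<dots>\<close>; the free module of rank \<open>r\<close> is the
  subset \<open>free_module r\<close>.
\<close>

type_synonym ('n, 'k) fvec = "nat \<Rightarrow>\<^sub>0 ('n, 'k) mpoly"

definition free_module :: "nat \<Rightarrow> (nat \<Rightarrow>\<^sub>0 'b::zero) set" where
  "free_module r = {v. Poly_Mapping.keys v \<subseteq> {..<r}}"

definition tdeg :: "'n::finite pp \<Rightarrow> nat" where
  "tdeg m = (\<Sum>x\<in>UNIV. Poly_Mapping.lookup m x)"

text \<open>
  Coefficientwise scaling. It is used both for the action of \<open>K\<close> on polynomials and on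
  vectors over \<open>K\<close>, and for the action of the polynomial ring on free modules.
\<close>

definition pscale :: "'b::mult_zero \<Rightarrow> ('a \<Rightarrow>\<^sub>0 'b) \<Rightarrow> ('a \<Rightarrow>\<^sub>0 'b)" where
  "pscale c v = Poly_Mapping.map ((*) c) v"

lemma lookup_pscale [simp]: "Poly_Mapping.lookup (pscale c v) i = c * Poly_Mapping.lookup v i"
  by (simp add: pscale_def Poly_Mapping.map.rep_eq when_def)

lemma module_pscale: "module (pscale :: 'b::comm_ring_1 \<Rightarrow> ('a \<Rightarrow>\<^sub>0 'b) \<Rightarrow> _)"
  by unfold_locales (auto intro!: poly_mapping_eqI simp: lookup_add algebra_simps)

lemma vector_space_pscale: "vector_space (pscale :: 'b::field \<Rightarrow> ('a \<Rightarrow>\<^sub>0 'b) \<Rightarrow> _)"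
  by unfold_locales (auto intro!: poly_mapping_eqI simp: lookup_add algebra_simps)

section \<open>Gradings\<close>

text \<open>
  The polynomial ring is graded by a weight \<open>w\<close> on power products, and the basis element
  \<open>e\<^sub>i\<close> has degree \<open>s i\<close>. The fine grading is given by the weight \<open>\<lambda>m. m\<close>, the standard
  grading by \<open>\<lambda>m. int (tdeg m)\<close>.
\<close>

definition homogeneous ::
    "('n pp \<Rightarrow> 'g::plus) \<Rightarrow> (nat \<Rightarrow> 'g) \<Rightarrow> 'g \<Rightarrow> ('n, 'k::zero) fvec \<Rightarrow> bool" where
  "homogeneous w s a v \<longleftrightarrow>
     (\<forall>i. \<forall>m\<in>Poly_Mapping.keys (Poly_Mapping.lookup v i). w m + s i = a)"

definition graded_submodule ::
    "('n pp \<Rightarrow> 'g::plus) \<Rightarrow> nat \<Rightarrow> (nat \<Rightarrow> 'g) \<Rightarrow> ('n, 'k::comm_ring_1) fvec set \<Rightarrow> bool" where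
  "graded_submodule w r s M \<longleftrightarrow>
     M \<subseteq> free_module r \<and> module.subspace pscale M \<and>
     (\<forall>v\<in>M. \<exists>A c. finite A \<and> (\<forall>a\<in>A. c a \<in> M \<and> homogeneous w s a (c a)) \<and> v = (\<Sum>a\<in>A. c a))"

abbreviation std_homogeneous ::
    "(nat \<Rightarrow> int) \<Rightarrow> int \<Rightarrow> ('n::finite, 'k::zero) fvec \<Rightarrow> bool" where
  "std_homogeneous \<equiv> homogeneous (\<lambda>m. int (tdeg m))"

section \<open>Graded Betti numbers\<close>

text \<open>
  A graded resolution \<open>\<dots> \<rightarrow> F\<^sub>1 \<rightarrow> F\<^sub>0 \<rightarrow> M \<rightarrow> 0\<close> by finitely generated free modules, where
  \<open>M\<close> lies in a free module whose basis has degrees \<open>ds\<close>. Here \<open>F\<^sub>k\<close> has rank \<open>b k\<close> and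
  basis degrees \<open>\<delta> k\<close>, the map \<open>\<phi> 0\<close> is the augmentation \<open>F\<^sub>0 \<rightarrow> M\<close>, and \<open>\<phi> (Suc k)\<close> maps
  \<open>F\<^sub>k\<^sub>+\<^sub>1\<close> to \<open>F\<^sub>k\<close>. Every linear map on \<open>free_module (b k)\<close> extends to the whole type, so
  linearity is required globally; all other conditions concern \<open>free_module (b k)\<close> only.
\<close>

definition graded_free_resolution ::
    "(nat \<Rightarrow> int) \<Rightarrow> ('n::finite, 'k::field) fvec set \<Rightarrow>
     (nat \<Rightarrow> nat) \<Rightarrow> (nat \<Rightarrow> nat \<Rightarrow> int) \<Rightarrow> (nat \<Rightarrow> ('n, 'k) fvec \<Rightarrow> ('n, 'k) fvec) \<Rightarrow> bool" where
  "graded_free_resolution ds M b \<delta> \<phi> \<longleftrightarrow>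
     (\<forall>k. module_hom pscale pscale (\<phi> k)) \<and>
     (\<forall>a. \<forall>v\<in>free_module (b 0).
        std_homogeneous (\<delta> 0) a v \<longrightarrow> std_homogeneous ds a (\<phi> 0 v)) \<and>
     (\<forall>k a. \<forall>v\<in>free_module (b (Suc k)).
        std_homogeneous (\<delta> (Suc k)) a v \<longrightarrow> std_homogeneous (\<delta> k) a (\<phi> (Suc k) v)) \<and>
     \<phi> 0 ` free_module (b 0) = M \<and>
     (\<forall>k. \<phi> (Suc k) ` free_module (b (Suc k)) = {v \<in> free_module (b k). \<phi> k v = 0})"

text \<open>
  Since \<open>K\<close> is the residue field at the variables, \<open>P\<^sup>b \<otimes> K = K\<^sup>b\<close>, the canonical map
  \<open>P\<^sup>b \<rightarrow> P\<^sup>b \<otimes> K\<close> takes constant terms, and a linear map \<open>f\<close> induces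
  \<open>f \<otimes> K : e\<^sub>j \<otimes> 1 \<mapsto> f e\<^sub>j \<otimes> 1\<close>.
\<close>

definition tensor_map ::
    "(('n, 'k::field) fvec \<Rightarrow> ('n, 'k) fvec) \<Rightarrow> (nat \<Rightarrow>\<^sub>0 'k) \<Rightarrow> (nat \<Rightarrow>\<^sub>0 'k)" where
  "tensor_map f c =
     Poly_Mapping.map (\<lambda>p. Poly_Mapping.lookup p 0) (f (Poly_Mapping.map (Poly_Mapping.single 0) c))"

definition tensor_component :: "nat \<Rightarrow> (nat \<Rightarrow> int) \<Rightarrow> int \<Rightarrow> (nat \<Rightarrow>\<^sub>0 'k::zero) set" where
  "tensor_component b \<delta> d = {c. Poly_Mapping.keys c \<subseteq> {j. j < b \<and> \<delta> j = d}}"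

text \<open>
  The dimension of the degree \<open>d\<close> part of \<open>H\<^sub>k(F \<otimes> K)\<close>, computed as cycles modulo boundaries
  in the finite-dimensional space \<open>(F\<^sub>k \<otimes> K)\<^sub>d\<close>. The augmentation is not part of the complex,
  so every element is a cycle for \<open>k = 0\<close>.
\<close>

definition tor_dim ::
    "(nat \<Rightarrow> nat) \<Rightarrow> (nat \<Rightarrow> nat \<Rightarrow> int) \<Rightarrow> (nat \<Rightarrow> ('n, 'k::field) fvec \<Rightarrow> ('n, 'k) fvec)
     \<Rightarrow> nat \<Rightarrow> int \<Rightarrow> nat" where
  "tor_dim b \<delta> \<phi> k d =
     vector_space.dim pscale
       {c \<in> tensor_component (b k) (\<delta> k) d. k = 0 \<or> tensor_map (\<phi> k) c = 0} -
     vector_space.dim pscale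
       (tensor_map (\<phi> (Suc k)) ` tensor_component (b (Suc k)) (\<delta> (Suc k)) d)"

text \<open>
  \<open>betti ds M k d\<close> is the dimension of \<open>Tor\<^sub>k(M, K)\<^sub>d\<close>, for a graded submodule \<open>M\<close> of the free
  module with basis degrees \<open>ds\<close>. As usual, Tor is computed from some chosen resolution.
\<close>

definition betti ::
    "(nat \<Rightarrow> int) \<Rightarrow> ('n::finite, 'k::field) fvec set \<Rightarrow> nat \<Rightarrow> int \<Rightarrow> nat" where
  "betti ds M k d =
     (case (SOME (b, \<delta>, \<phi>). graded_free_resolution ds M b \<delta> \<phi>) of
        (b, \<delta>, \<phi>) \<Rightarrow> tor_dim b \<delta> \<phi> k d)"

section \<open>Distractions\<close>

definition linear_forms :: "('n::finite, 'k::zero) mpoly set" where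
  "linear_forms = {p. \<forall>m\<in>Poly_Mapping.keys p. tdeg m = 1}"

text \<open>Columns are numbered from 1; the values \<open>L i 0\<close> are irrelevant.\<close>

definition distraction_matrix :: "('n::finite \<Rightarrow> nat \<Rightarrow> ('n, 'k::field) mpoly) \<Rightarrow> bool" where
  "distraction_matrix L \<longleftrightarrow>
     (\<forall>i. \<forall>j\<ge>1. L i j \<in> linear_forms) \<and>
     (\<forall>\<sigma>. (\<forall>i. \<sigma> i \<ge> 1) \<longrightarrow> module.span pscale ((\<lambda>i. L i (\<sigma> i)) ` UNIV) = linear_forms) \<and>
     (\<exists>N\<ge>1. \<forall>i. \<forall>j>N. L i j = L i N)"

definition distr_pp ::
    "('n::finite \<Rightarrow> nat \<Rightarrow> ('n, 'k::field) mpoly) \<Rightarrow> 'n pp \<Rightarrow> ('n, 'k) mpoly" where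
  "distr_pp L m = (\<Prod>i\<in>UNIV. \<Prod>j=1..Poly_Mapping.lookup m i. L i j)"

text \<open>The quotient \<open>D\<^sub>L(m s) / D\<^sub>L(s)\<close> in the polynomial ring.\<close>

definition distr_quot ::
    "('n::finite \<Rightarrow> nat \<Rightarrow> ('n, 'k::field) mpoly) \<Rightarrow> 'n pp \<Rightarrow> 'n pp \<Rightarrow> ('n, 'k) mpoly" where
  "distr_quot L s m = (THE q. distr_pp L (m + s) = q * distr_pp L s)"

text \<open>
  The distraction on the free module whose basis element \<open>e\<^sub>i\<close> has multidegree \<open>t i\<close>: the
  \<open>K\<close>-linear extension of \<open>m e\<^sub>i \<mapsto> (D\<^sub>L(m t\<^sub>i) / D\<^sub>L(t\<^sub>i)) e\<^sub>i\<close>.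
\<close>

definition distraction ::
    "('n::finite \<Rightarrow> nat \<Rightarrow> ('n, 'k::field) mpoly) \<Rightarrow> (nat \<Rightarrow> 'n pp) \<Rightarrow>
     ('n, 'k) fvec \<Rightarrow> ('n, 'k) fvec" where
  "distraction L t v =
     (\<Sum>i\<in>Poly_Mapping.keys v. Poly_Mapping.single i
        (\<Sum>m\<in>Poly_Mapping.keys (Poly_Mapping.lookup v i).
           pscale (Poly_Mapping.lookup (Poly_Mapping.lookup v i) m) (distr_quot L (t i) m)))"

end

theory Submission
  imports Defs
begin

text \<open>
  The \<open>K\<close>-linear map \<open>D\<^sub>L\<close> between free modules is bijective: the products \<open>D\<^sub>L(s m) / D\<^sub>L(s)\<close>
  over all power products \<open>m\<close> of degree \<open>d\<close> span the forms of degree \<open>d\<close>, because any column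
  choice of \<open>L\<close> spans the linear forms, and there are exactly as many of them as monomials of
  degree \<open>d\<close>. If \<open>f\<close> is a multigraded \<open>P\<close>-linear map between multigraded free modules, then the
  conjugate of \<open>f\<close> by \<open>D\<^sub>L\<close> is again \<open>P\<close>-linear. Hence \<open>D\<^sub>L\<close> carries a multigraded free
  resolution of \<open>M\<close> (which exists by Dickson's lemma) to a standard graded free resolution of
  \<open>D\<^sub>L(M)\<close> with the same ranks and degrees. The matrix entries of the two resolutions have the
  same constant terms, so after tensoring with \<open>K\<close> the two complexes coincide; and Tor does not
  depend on the chosen resolution.
\<close>

section \<open>Free modules\<close>

text \<open>\<open>D\<close> is only K-linear: multiplying a vector by a variable becomes
  multiplication by a linear form that depends on the columns already used, hence in general on the
  component. What saves the argument is that all nonzero components of a vector of multidegree a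
  have used the same columns, those counted by a; multiplication by a power product m then becomes
  multiplication by the one form D(a m)/D(a) in every component. This is why a multigraded
  resolution is transported: its basis elements have multihomogeneous images. The resolutions that
  arise need not be minimal, so equal ranks alone do not give equal Betti numbers and the complexes
  are compared after reduction modulo the variables. Since \<open>betti\<close> evaluates an
  arbitrarily chosen resolution, the comparison theorem is established for graded resolutions that
  may be infinitely long.\<close>

abbreviation lookup :: "('a \<Rightarrow>\<^sub>0 'b::zero) \<Rightarrow> 'a \<Rightarrow> 'b" where "lookup \<equiv> Poly_Mapping.lookup"
abbreviation keys :: "('a \<Rightarrow>\<^sub>0 'b::zero) \<Rightarrow> 'a set" where "keys \<equiv> Poly_Mapping.keys"
abbreviation single :: "'a \<Rightarrow> 'b \<Rightarrow> ('a \<Rightarrow>\<^sub>0 'b::zero)" where "single \<equiv> Poly_Mapping.single"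

interpretation pm: module "pscale :: 'b::comm_ring_1 \<Rightarrow> ('a \<Rightarrow>\<^sub>0 'b) \<Rightarrow> _"
  by (rule module_pscale)

interpretation pv: vector_space "pscale :: 'b::field \<Rightarrow> ('a \<Rightarrow>\<^sub>0 'b) \<Rightarrow> _"
  by (rule vector_space_pscale)

abbreviation is_linear :: "(('a \<Rightarrow>\<^sub>0 'b::comm_ring_1) \<Rightarrow> ('c \<Rightarrow>\<^sub>0 'b)) \<Rightarrow> bool" where
  "is_linear \<equiv> module_hom pscale pscale"

lemma is_linear_iff:
  "is_linear f \<longleftrightarrow> (\<forall>u v. f (u + v) = f u + f v) \<and> (\<forall>c v. f (pscale c v) = pscale c (f v))"
  by (simp add: module_hom_iff module_pscale)

lemma is_linear_compose: "is_linear f \<Longrightarrow> is_linear g \<Longrightarrow> is_linear (\<lambda>v. g (f v))"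
  by (simp add: is_linear_iff)

lemma is_linear_diff: "is_linear f \<Longrightarrow> is_linear g \<Longrightarrow> is_linear (\<lambda>v. f v - g v)"
  by (simp add: is_linear_iff pm.scale_right_diff_distrib)

lemma is_linear_ident: "is_linear (\<lambda>v. v)"
  by (simp add: is_linear_iff)

lemma free_module_iff: "v \<in> free_module r \<longleftrightarrow> (\<forall>j\<ge>r. lookup v j = 0)"
  unfolding free_module_def subset_iff mem_Collect_eq in_keys_iff lessThan_iff
  using not_le by blast

lemma subspace_free_module: "pm.subspace (free_module r)"
  by (rule pm.subspaceI) (simp_all add: free_module_iff lookup_add)

lemma free_module_SucD: "v \<in> free_module (Suc i) \<Longrightarrow> lookup v i = 0 \<Longrightarrow> v \<in> free_module i"
  unfolding free_module_iff by (metis le_antisym not_less_eq_eq)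

lemma single_in_free_module: "j < r \<Longrightarrow> single j p \<in> free_module r"
  by (auto simp: free_module_def)

lemma free_module_expand:
  fixes v :: "nat \<Rightarrow>\<^sub>0 'b::comm_ring_1"
  assumes "v \<in> free_module b"
  shows "v = (\<Sum>j<b. pscale (lookup v j) (single j 1))"
proof (rule poly_mapping_eqI)
  fix i
  have "lookup (\<Sum>j<b. pscale (lookup v j) (single j 1)) i = (\<Sum>j<b. if j = i then lookup v j else 0)"
    unfolding lookup_sum by (rule sum.cong) (auto simp: lookup_single when_def)
  then show "lookup v i = lookup (\<Sum>j<b. pscale (lookup v j) (single j 1)) i"
    using assms by (auto simp: free_module_iff not_less)
qed

text \<open>Coordinates from \<open>b\<close> on are discarded, so values prescribed on finitely
  many basis elements give a map that is linear on the whole type, as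
  \<open>graded_free_resolution\<close> demands.\<close>

definition lin_ext :: "nat \<Rightarrow> (nat \<Rightarrow> ('a \<Rightarrow>\<^sub>0 'b)) \<Rightarrow> (nat \<Rightarrow>\<^sub>0 'b::comm_ring_1) \<Rightarrow> ('a \<Rightarrow>\<^sub>0 'b)" where
  "lin_ext b w v = (\<Sum>j<b. pscale (lookup v j) (w j))"

lemma is_linear_lin_ext: "is_linear (lin_ext b w)"
  by (simp add: is_linear_iff lin_ext_def lookup_add pm.scale_left_distrib sum.distrib
      pm.scale_sum_right)

lemma lin_ext_single:
  assumes "j < b"
  shows "lin_ext b w (single j p) = pscale p (w j)"
proof -
  have "lin_ext b w (single j p) = (\<Sum>i<b. if i = j then pscale p (w j) else 0)"
    unfolding lin_ext_def by (rule sum.cong) (auto simp: lookup_single when_def)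
  with assms show ?thesis by simp
qed

lemma is_linear_eq_lin_ext:
  assumes "is_linear f" "v \<in> free_module b"
  shows "f v = lin_ext b (\<lambda>j. f (single j 1)) v"
proof -
  interpret module_hom pscale pscale f by fact
  have "f v = f (\<Sum>j<b. pscale (lookup v j) (single j 1))"
    using free_module_expand[OF assms(2)] by simp
  then show ?thesis
    by (simp add: lin_ext_def sum scale)
qed

lemma lin_ext_mem:
  assumes "pm.subspace S" "\<And>j. j < b \<Longrightarrow> w j \<in> S"
  shows "lin_ext b w v \<in> S"
  unfolding lin_ext_def using assms by (auto intro!: pm.subspace_sum pm.subspace_scale)

section \<open>Homogeneous components and projectivity of graded free modules\<close>

section \<open>Homogeneous elements and graded maps\<close>

lemma homogeneous_zero: "homogeneous w s a 0"
  by (simp add: homogeneous_def)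

lemma homogeneous_iff:
  "homogeneous w s a v \<longleftrightarrow> (\<forall>i m. lookup (lookup v i) m \<noteq> 0 \<longrightarrow> w m + s i = a)"
  by (auto simp: homogeneous_def in_keys_iff)

lemma homogeneous_add:
  fixes u v :: "('n, 'k::monoid_add) fvec"
  shows "homogeneous w s a u \<Longrightarrow> homogeneous w s a v \<Longrightarrow> homogeneous w s a (u + v)"
  unfolding homogeneous_iff lookup_add by (metis add_0_left)

lemma homogeneous_diff:
  fixes u v :: "('n, 'k::ab_group_add) fvec"
  shows "homogeneous w s a u \<Longrightarrow> homogeneous w s a v \<Longrightarrow> homogeneous w s a (u - v)"
  unfolding homogeneous_iff lookup_minus by (metis diff_0_right)

lemma homogeneous_sum:
  fixes f :: "'i \<Rightarrow> ('n, 'k::comm_monoid_add) fvec"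
  shows "(\<And>j. j \<in> A \<Longrightarrow> homogeneous w s a (f j)) \<Longrightarrow> homogeneous w s a (\<Sum>j\<in>A. f j)"
  by (induction A rule: infinite_finite_induct) (auto intro: homogeneous_add homogeneous_zero)

definition hcomp ::
    "('n pp \<Rightarrow> 'g::plus) \<Rightarrow> (nat \<Rightarrow> 'g) \<Rightarrow> 'g \<Rightarrow> ('n, 'k::zero) fvec \<Rightarrow> ('n, 'k) fvec" where
  "hcomp w s a =
     Poly_Mapping.mapp (\<lambda>i. Poly_Mapping.mapp (\<lambda>m c. if w m + s i = a then c else 0))"

lemma lookup_hcomp:
  "lookup (lookup (hcomp w s a v) i) m = (if w m + s i = a then lookup (lookup v i) m else 0)"
  by (auto simp: hcomp_def lookup_mapp when_def in_keys_iff)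

lemma lookup_hcomp_eq_0: "lookup v i = 0 \<Longrightarrow> lookup (hcomp w s a v) i = 0"
  by (rule poly_mapping_eqI) (simp add: lookup_hcomp)

lemma hcomp_in_free_module: "v \<in> free_module b \<Longrightarrow> hcomp w s a v \<in> free_module b"
  by (simp add: free_module_iff lookup_hcomp_eq_0)

lemma homogeneous_hcomp: "homogeneous w s a (hcomp w s a v)"
  by (auto simp: homogeneous_iff lookup_hcomp split: if_splits)

lemma fvec_eqI: "(\<And>i m. lookup (lookup u i) m = lookup (lookup v i) m) \<Longrightarrow> u = v"
  by (intro poly_mapping_eqI)

lemma hcomp_homogeneous: "homogeneous w s a v \<Longrightarrow> hcomp w s c v = (if a = c then v else 0)"
  by (rule fvec_eqI) (auto simp: homogeneous_iff lookup_hcomp)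

lemma hcomp_sum:
  fixes f :: "'i \<Rightarrow> ('n, 'k::comm_monoid_add) fvec"
  shows "hcomp w s a (\<Sum>j\<in>A. f j) = (\<Sum>j\<in>A. hcomp w s a (f j))"
  by (rule fvec_eqI) (simp add: lookup_hcomp lookup_sum)

definition degrees_of :: "('n pp \<Rightarrow> 'g::plus) \<Rightarrow> (nat \<Rightarrow> 'g) \<Rightarrow> ('n, 'k::zero) fvec \<Rightarrow> 'g set" where
  "degrees_of w s v = (\<Union>i\<in>keys v. (\<lambda>m. w m + s i) ` keys (lookup v i))"

lemma finite_degrees_of: "finite (degrees_of w s v)"
  by (simp add: degrees_of_def)

lemma degrees_ofI:
  assumes "lookup (lookup v i) m \<noteq> 0"
  shows "w m + s i \<in> degrees_of w s v"
proof -
  from assms have "m \<in> keys (lookup v i)" "i \<in> keys v"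
    by (auto simp: in_keys_iff)
  then show ?thesis unfolding degrees_of_def by blast
qed

lemma sum_hcomp:
  fixes v :: "('n, 'k::comm_monoid_add) fvec"
  shows "(\<Sum>a\<in>degrees_of w s v. hcomp w s a v) = v"
proof (rule fvec_eqI)
  fix i m
  have "lookup (lookup (\<Sum>a\<in>degrees_of w s v. hcomp w s a v) i) m =
      (\<Sum>a\<in>degrees_of w s v. if a = w m + s i then lookup (lookup v i) m else 0)"
    unfolding lookup_sum lookup_hcomp by (rule sum.cong) simp_all
  also have "\<dots> = lookup (lookup v i) m"
    using degrees_ofI[of v i m w s] by (auto simp: finite_degrees_of)
  finally show "lookup (lookup (\<Sum>a\<in>degrees_of w s v. hcomp w s a v) i) m = lookup (lookup v i) m" .
qed

definition graded_map ::
    "('n pp \<Rightarrow> 'g::plus) \<Rightarrow> nat \<Rightarrow> (nat \<Rightarrow> 'g) \<Rightarrow> (nat \<Rightarrow> 'g) \<Rightarrow>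
     (('n, 'k::comm_ring_1) fvec \<Rightarrow> ('n, 'k) fvec) \<Rightarrow> bool" where
  "graded_map w b s s' f \<longleftrightarrow> is_linear f \<and>
     (\<forall>a. \<forall>v\<in>free_module b. homogeneous w s a v \<longrightarrow> homogeneous w s' a (f v))"

lemma graded_map_linear: "graded_map w b s s' f \<Longrightarrow> is_linear f"
  by (simp add: graded_map_def)

lemma graded_map_homogeneous:
  "graded_map w b s s' f \<Longrightarrow> v \<in> free_module b \<Longrightarrow> homogeneous w s a v \<Longrightarrow> homogeneous w s' a (f v)"
  by (simp add: graded_map_def)

lemma graded_map_ident: "graded_map w b s s (\<lambda>v. v)"
  by (simp add: graded_map_def is_linear_ident)

lemma graded_map_diff:
  "graded_map w b s s' f \<Longrightarrow> graded_map w b s s' g \<Longrightarrow> graded_map w b s s' (\<lambda>v. f v - g v)"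
  by (simp add: graded_map_def is_linear_diff homogeneous_diff)

lemma graded_map_compose:
  assumes "graded_map w b s s' f" "graded_map w b' s' s'' g" "f ` free_module b \<subseteq> free_module b'"
  shows "graded_map w b s s'' (\<lambda>v. g (f v))"
  using assms unfolding graded_map_def by (auto intro: is_linear_compose)

text \<open>\<open>f\<close> preserves the degree of each homogeneous component of \<open>v\<close>,
  so extracting degree \<open>a\<close> from the sum of their images leaves at most one of them.
  This lets preimages of homogeneous elements be chosen homogeneous and shows that kernels are
  graded.\<close>

lemma graded_map_hcomp:
  assumes f: "graded_map w b s s' f" and v: "v \<in> free_module b"
  shows "f (hcomp w s a v) = hcomp w s' a (f v)"
proof -
  interpret module_hom pscale pscale f by (rule graded_map_linear[OF f])
  have *: "homogeneous w s' c (f (hcomp w s c v))" for c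
    using f v by (simp add: graded_map_homogeneous hcomp_in_free_module homogeneous_hcomp)
  have "hcomp w s' a (f v) = (\<Sum>c\<in>degrees_of w s v. hcomp w s' a (f (hcomp w s c v)))"
    unfolding hcomp_sum[symmetric] sum[symmetric] sum_hcomp ..
  also have "\<dots> = (\<Sum>c\<in>degrees_of w s v. if c = a then f (hcomp w s a v) else 0)"
    by (rule sum.cong) (simp_all add: hcomp_homogeneous[OF *])
  also have "\<dots> = f (hcomp w s a v)"
  proof (cases "a \<in> degrees_of w s v")
    case False
    have "hcomp w s a v = 0"
    proof (rule fvec_eqI)
      fix i m
      show "lookup (lookup (hcomp w s a v) i) m = lookup (lookup 0 i) m"
        using False degrees_ofI[of v i m w s] by (auto simp: lookup_hcomp)
    qed
    with False show ?thesis by (simp add: finite_degrees_of)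
  qed (simp add: finite_degrees_of)
  finally show ?thesis by simp
qed

text \<open>The lifting argument asks of a grading that its weight be a monoid homomorphism; the
  standard and the fine grading are both instances.\<close>

locale pp_weight =
  fixes w :: "'n pp \<Rightarrow> 'g::comm_monoid_add"
  assumes weight_zero: "w 0 = 0" and weight_add: "w (m + m') = w m + w m'"
begin

lemma homogeneous_single: "homogeneous w s (s j) (single j 1 :: ('n, 'k::comm_ring_1) fvec)"
  by (auto simp: homogeneous_iff lookup_single when_def lookup_one weight_zero split: if_splits)

lemma homogeneous_pscale:
  assumes "homogeneous w s a v" "\<And>m. m \<in> keys p \<Longrightarrow> w m = c"
  shows "homogeneous w s (c + a) (pscale p v)"
  unfolding homogeneous_def
proof (intro allI ballI)
  fix i m assume "m \<in> keys (lookup (pscale p v) i)"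
  then obtain m1 m2 where "m1 \<in> keys p" "m2 \<in> keys (lookup v i)" "m = m1 + m2"
    using keys_mult[of p "lookup v i"] by auto
  with assms show "w m + s i = c + a"
    by (auto simp: homogeneous_def weight_add add.assoc)
qed

lemma graded_mapI:
  fixes f :: "('n, 'k::comm_ring_1) fvec \<Rightarrow> ('n, 'k) fvec"
  assumes f: "is_linear f" and h: "\<And>j. j < b \<Longrightarrow> homogeneous w s' (s j) (f (single j 1))"
  shows "graded_map w b s s' f"
  unfolding graded_map_def
proof (intro conjI allI ballI impI f)
  fix a and v :: "('n, 'k) fvec"
  assume v: "v \<in> free_module b" and hv: "homogeneous w s a v"
  have "homogeneous w s' a (pscale (lookup v j) (f (single j 1)))" if "j < b" for j
  proof (unfold homogeneous_def, intro allI ballI)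
    fix i m assume "m \<in> keys (lookup (pscale (lookup v j) (f (single j 1))) i)"
    then obtain m1 m2 where m: "m1 \<in> keys (lookup v j)" "m2 \<in> keys (lookup (f (single j 1)) i)"
      "m = m1 + m2"
      using keys_mult[of "lookup v j" "lookup (f (single j 1)) i"] by auto
    have "w m + s' i = w m1 + (w m2 + s' i)" using m by (simp add: weight_add add.assoc)
    also have "\<dots> = w m1 + s j" using h[OF that] m by (simp add: homogeneous_def)
    also have "\<dots> = a" using hv m by (simp add: homogeneous_def)
    finally show "w m + s' i = a" .
  qed
  then show "homogeneous w s' a (f v)"
    unfolding is_linear_eq_lin_ext[OF f v] lin_ext_def by (intro homogeneous_sum) auto
qed

text \<open>Projectivity of graded free modules: a preimage of \<open>u (single j 1)\<close> under
  \<open>g\<close> may be replaced by its component of degree \<open>s j\<close>, and the chosen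
  preimages extend linearly. Chain maps and homotopies both come from here.\<close>

lemma graded_map_lift:
  fixes g u :: "('n, 'k::comm_ring_1) fvec \<Rightarrow> ('n, 'k) fvec"
  assumes g: "graded_map w b' s' s0 g" and u: "graded_map w b s s0 u"
    and im: "u ` free_module b \<subseteq> g ` free_module b'"
  shows "\<exists>f. graded_map w b s s' f \<and> f ` free_module b \<subseteq> free_module b' \<and>
             (\<forall>v\<in>free_module b. g (f v) = u v)"
proof -
  have "\<exists>x\<in>free_module b'. homogeneous w s' (s j) x \<and> g x = u (single j 1)" if "j < b" for j
  proof -
    have e: "(single j 1 :: ('n, 'k) fvec) \<in> free_module b"
      using that by (rule single_in_free_module)
    then have "u (single j 1) \<in> g ` free_module b'"
      using im by (auto simp: image_subset_iff)
    then obtain x where x: "x \<in> free_module b'" "g x = u (single j 1)" by auto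
    have "g (hcomp w s' (s j) x) = hcomp w s0 (s j) (u (single j 1))"
      using graded_map_hcomp[OF g x(1)] x(2) by simp
    also have "\<dots> = u (single j 1)"
      using hcomp_homogeneous[OF graded_map_homogeneous[OF u e homogeneous_single]] by simp
    finally show ?thesis
      using x by (intro bexI[of _ "hcomp w s' (s j) x"])
        (auto simp: homogeneous_hcomp hcomp_in_free_module)
  qed
  then obtain y where y: "\<And>j. j < b \<Longrightarrow> y j \<in> free_module b'"
    "\<And>j. j < b \<Longrightarrow> homogeneous w s' (s j) (y j)" "\<And>j. j < b \<Longrightarrow> g (y j) = u (single j 1)"
    by metis
  let ?f = "lin_ext b y"
  have "graded_map w b s s' ?f"
    by (intro graded_mapI is_linear_lin_ext) (simp add: lin_ext_single y)
  moreover have "?f ` free_module b \<subseteq> free_module b'"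
    using y by (auto intro!: lin_ext_mem subspace_free_module)
  moreover have "g (?f v) = u v" if v: "v \<in> free_module b" for v
  proof -
    have "g (?f v) = lin_ext b (\<lambda>j. g (?f (single j 1))) v"
      by (rule is_linear_eq_lin_ext[OF is_linear_compose[OF is_linear_lin_ext graded_map_linear[OF g]] v])
    also have "\<dots> = lin_ext b (\<lambda>j. u (single j 1)) v"
      by (simp add: lin_ext_def[of b "\<lambda>j. u (single j 1)"] lin_ext_def[of b "\<lambda>j. g (?f (single j 1))"]
          lin_ext_single y)
    also have "\<dots> = u v" by (rule is_linear_eq_lin_ext[OF graded_map_linear[OF u] v, symmetric])
    finally show ?thesis .
  qed
  ultimately show ?thesis by blast
qed

end

lemma tdeg_add: "tdeg (m + m') = tdeg m + tdeg m'"
  by (simp add: tdeg_def lookup_add sum.distrib)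

lemma tdeg_zero: "tdeg 0 = 0"
  by (simp add: tdeg_def)

interpretation std: pp_weight "\<lambda>m. int (tdeg m)"
  by unfold_locales (simp_all add: tdeg_add tdeg_zero)

interpretation fine: pp_weight "\<lambda>m. m"
  by unfold_locales simp_all

section \<open>Lifting the identity of a module to chain maps, and null homotopies\<close>

section \<open>Comparison of resolutions\<close>

abbreviation std_map ::
    "nat \<Rightarrow> (nat \<Rightarrow> int) \<Rightarrow> (nat \<Rightarrow> int) \<Rightarrow> (('n::finite, 'k::comm_ring_1) fvec \<Rightarrow> ('n, 'k) fvec) \<Rightarrow> bool" where
  "std_map \<equiv> graded_map (\<lambda>m. int (tdeg m))"

lemma graded_free_resolution_iff:
  "graded_free_resolution ds M b \<delta> \<phi> \<longleftrightarrow>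
     std_map (b 0) (\<delta> 0) ds (\<phi> 0) \<and>
     (\<forall>k. std_map (b (Suc k)) (\<delta> (Suc k)) (\<delta> k) (\<phi> (Suc k))) \<and>
     \<phi> 0 ` free_module (b 0) = M \<and>
     (\<forall>k. \<phi> (Suc k) ` free_module (b (Suc k)) = {v \<in> free_module (b k). \<phi> k v = 0})"
  unfolding graded_free_resolution_def graded_map_def
  by (auto simp: all_conj_distrib) (metis not0_implies_Suc)+

lemma resolution_boundary:
  assumes "graded_free_resolution ds M b \<delta> \<phi>" "v \<in> free_module (b (Suc k))"
  shows "\<phi> (Suc k) v \<in> free_module (b k)" "\<phi> k (\<phi> (Suc k) v) = 0"
proof -
  have "\<phi> (Suc k) v \<in> \<phi> (Suc k) ` free_module (b (Suc k))" using assms(2) by (rule imageI)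
  also have "\<dots> = {v \<in> free_module (b k). \<phi> k v = 0}"
    using assms(1) by (simp add: graded_free_resolution_iff)
  finally show "\<phi> (Suc k) v \<in> free_module (b k)" "\<phi> k (\<phi> (Suc k) v) = 0" by simp_all
qed

lemma resolution_exact:
  assumes "graded_free_resolution ds M b \<delta> \<phi>" "v \<in> free_module (b k)" "\<phi> k v = 0"
  shows "v \<in> \<phi> (Suc k) ` free_module (b (Suc k))"
  using assms by (simp add: graded_free_resolution_iff)

definition chain_map ::
    "(nat \<Rightarrow> nat) \<Rightarrow> (nat \<Rightarrow> nat \<Rightarrow> int) \<Rightarrow> (nat \<Rightarrow> ('n::finite, 'k::field) fvec \<Rightarrow> ('n, 'k) fvec) \<Rightarrow>
     (nat \<Rightarrow> nat) \<Rightarrow> (nat \<Rightarrow> nat \<Rightarrow> int) \<Rightarrow> (nat \<Rightarrow> ('n, 'k) fvec \<Rightarrow> ('n, 'k) fvec) \<Rightarrow>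
     (nat \<Rightarrow> ('n, 'k) fvec \<Rightarrow> ('n, 'k) fvec) \<Rightarrow> bool" where
  "chain_map b \<delta> \<phi> b' \<delta>' \<phi>' f \<longleftrightarrow>
     (\<forall>k. std_map (b k) (\<delta> k) (\<delta>' k) (f k) \<and> f k ` free_module (b k) \<subseteq> free_module (b' k)) \<and>
     (\<forall>v\<in>free_module (b 0). \<phi>' 0 (f 0 v) = \<phi> 0 v) \<and>
     (\<forall>k. \<forall>v\<in>free_module (b (Suc k)). \<phi>' (Suc k) (f (Suc k) v) = f k (\<phi> (Suc k) v))"

text \<open>Each map lifts the preceding composite through \<open>\<phi>' (Suc k)\<close>. The lift
  exists once the map built so far sends cycles to cycles, since exactness turns those into
  boundaries; the last clause of \<open>P\<close> carries this along.\<close>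

lemma chain_map_exists:
  fixes \<phi> \<phi>' :: "nat \<Rightarrow> ('n::finite, 'k::field) fvec \<Rightarrow> ('n, 'k) fvec"
  assumes R: "graded_free_resolution ds M b \<delta> \<phi>" and R': "graded_free_resolution ds M b' \<delta>' \<phi>'"
  shows "\<exists>f. chain_map b \<delta> \<phi> b' \<delta>' \<phi>' f"
proof -
  define P where "P k f \<longleftrightarrow> std_map (b k) (\<delta> k) (\<delta>' k) f \<and> f ` free_module (b k) \<subseteq> free_module (b' k) \<and>
      (k = 0 \<longrightarrow> (\<forall>v\<in>free_module (b 0). \<phi>' 0 (f v) = \<phi> 0 v)) \<and>
      (\<forall>v\<in>free_module (b k). \<phi> k v = 0 \<longrightarrow> \<phi>' k (f v) = 0)" for k f
  define Q where "Q k f g \<longleftrightarrow> (\<forall>v\<in>free_module (b (Suc k)). \<phi>' (Suc k) (g v) = f (\<phi> (Suc k) v))"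
    for k f g
  have "\<exists>f. \<forall>k. P k (f k) \<and> Q k (f k) (f (Suc k))"
  proof (rule dependent_nat_choice)
    have "\<exists>f. std_map (b 0) (\<delta> 0) (\<delta>' 0) f \<and> f ` free_module (b 0) \<subseteq> free_module (b' 0) \<and>
             (\<forall>v\<in>free_module (b 0). \<phi>' 0 (f v) = \<phi> 0 v)"
      by (rule std.graded_map_lift[of _ _ ds])
         (use R R' in \<open>auto simp: graded_free_resolution_iff\<close>)
    then show "\<exists>f. P 0 f" unfolding P_def by auto
  next
    fix f k assume f: "P k f"
    have "\<exists>g. std_map (b (Suc k)) (\<delta> (Suc k)) (\<delta>' (Suc k)) g \<and>
        g ` free_module (b (Suc k)) \<subseteq> free_module (b' (Suc k)) \<and>
        (\<forall>v\<in>free_module (b (Suc k)). \<phi>' (Suc k) (g v) = f (\<phi> (Suc k) v))"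
    proof (rule std.graded_map_lift[of _ _ "\<delta>' k"])
      show "std_map (b' (Suc k)) (\<delta>' (Suc k)) (\<delta>' k) (\<phi>' (Suc k))"
        using R' by (simp add: graded_free_resolution_iff)
      show "std_map (b (Suc k)) (\<delta> (Suc k)) (\<delta>' k) (\<lambda>v. f (\<phi> (Suc k) v))"
        by (rule graded_map_compose[of _ _ _ "\<delta> k" _ "b k"])
           (use R f resolution_boundary[OF R] in \<open>auto simp: graded_free_resolution_iff P_def\<close>)
      show "(\<lambda>v. f (\<phi> (Suc k) v)) ` free_module (b (Suc k)) \<subseteq> \<phi>' (Suc k) ` free_module (b' (Suc k))"
      proof safe
        fix v :: "('n, 'k) fvec" assume "v \<in> free_module (b (Suc k))"
        from resolution_boundary[OF R this] f
        show "f (\<phi> (Suc k) v) \<in> \<phi>' (Suc k) ` free_module (b' (Suc k))"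
          by (intro resolution_exact[OF R']) (auto simp: P_def)
      qed
    qed
    \<comment> \<open>Where \<open>\<phi> (Suc k)\<close> vanishes,
      \<open>\<phi>' (Suc k) (g v)\<close> equals \<open>f 0\<close>, so this renews the invariant
      on cycles.\<close>
    moreover have "f 0 = 0"
      using f unfolding P_def graded_map_def by (auto intro: module_hom.zero)
    ultimately show "\<exists>g. P (Suc k) g \<and> Q k f g"
      unfolding P_def Q_def by auto
  qed
  then obtain f where "\<And>k. P k (f k)" "\<And>k. Q k (f k) (f (Suc k))" by blast
  then have "chain_map b \<delta> \<phi> b' \<delta>' \<phi>' f"
    unfolding chain_map_def P_def Q_def by blast
  then show ?thesis by (intro exI[of _ f])
qed

text \<open>\<open>c\<close> lifts the zero map of \<open>M\<close>; it will be the identity minus a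
  round trip between two resolutions. Each new homotopy lifts
  \<open>c (Suc k) v - h k (\<phi> (Suc k) v)\<close>, which is a cycle because
  \<open>\<phi> (Suc k) (h k v) = c k v\<close> already holds for cycles \<open>v\<close>.\<close>

lemma null_homotopy_exists:
  fixes \<phi> :: "nat \<Rightarrow> ('n::finite, 'k::field) fvec \<Rightarrow> ('n, 'k) fvec"
  assumes R: "graded_free_resolution ds M b \<delta> \<phi>"
    and c: "\<And>k. std_map (b k) (\<delta> k) (\<delta> k) (c k)" "\<And>k. c k ` free_module (b k) \<subseteq> free_module (b k)"
    and c0: "\<And>v. v \<in> free_module (b 0) \<Longrightarrow> \<phi> 0 (c 0 v) = 0"
    and cS: "\<And>k v. v \<in> free_module (b (Suc k)) \<Longrightarrow> \<phi> (Suc k) (c (Suc k) v) = c k (\<phi> (Suc k) v)"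
  shows "\<exists>h. (\<forall>k. std_map (b k) (\<delta> k) (\<delta> (Suc k)) (h k) \<and>
                  h k ` free_module (b k) \<subseteq> free_module (b (Suc k))) \<and>
             (\<forall>v\<in>free_module (b 0). \<phi> (Suc 0) (h 0 v) = c 0 v) \<and>
             (\<forall>k. \<forall>v\<in>free_module (b (Suc k)).
                \<phi> (Suc (Suc k)) (h (Suc k) v) = c (Suc k) v - h k (\<phi> (Suc k) v))"
proof -
  define P where "P k h \<longleftrightarrow> std_map (b k) (\<delta> k) (\<delta> (Suc k)) h \<and>
      h ` free_module (b k) \<subseteq> free_module (b (Suc k)) \<and>
      (k = 0 \<longrightarrow> (\<forall>v\<in>free_module (b 0). \<phi> (Suc 0) (h v) = c 0 v)) \<and>
      (\<forall>v\<in>free_module (b k). \<phi> k v = 0 \<longrightarrow> \<phi> (Suc k) (h v) = c k v)" for k h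
  define Q where "Q k h h' \<longleftrightarrow>
      (\<forall>v\<in>free_module (b (Suc k)). \<phi> (Suc (Suc k)) (h' v) = c (Suc k) v - h (\<phi> (Suc k) v))"
    for k h h'
  have "\<exists>h. \<forall>k. P k (h k) \<and> Q k (h k) (h (Suc k))"
  proof (rule dependent_nat_choice)
    have "\<exists>f. std_map (b 0) (\<delta> 0) (\<delta> (Suc 0)) f \<and> f ` free_module (b 0) \<subseteq> free_module (b (Suc 0)) \<and>
             (\<forall>v\<in>free_module (b 0). \<phi> (Suc 0) (f v) = c 0 v)"
    proof (rule std.graded_map_lift[of _ _ "\<delta> 0"])
      show "std_map (b (Suc 0)) (\<delta> (Suc 0)) (\<delta> 0) (\<phi> (Suc 0))"
        using R by (simp add: graded_free_resolution_iff)
      show "c 0 ` free_module (b 0) \<subseteq> \<phi> (Suc 0) ` free_module (b (Suc 0))"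
        using c(2)[of 0] c0 by (auto intro!: resolution_exact[OF R])
    qed (rule c)
    then show "\<exists>h. P 0 h" unfolding P_def by auto
  next
    fix h k assume h: "P k h"
    then interpret h: module_hom pscale pscale h by (simp add: P_def graded_map_def)
    from c(1)[of "Suc k"] interpret c: module_hom pscale pscale "c (Suc k)"
      by (simp add: graded_map_def)
    have lin: "is_linear (\<phi> (Suc k))" using R by (simp add: graded_free_resolution_def)
    then interpret \<phi>: module_hom pscale pscale "\<phi> (Suc k)" .
    have "\<exists>g. std_map (b (Suc k)) (\<delta> (Suc k)) (\<delta> (Suc (Suc k))) g \<and>
        g ` free_module (b (Suc k)) \<subseteq> free_module (b (Suc (Suc k))) \<and>
        (\<forall>v\<in>free_module (b (Suc k)). \<phi> (Suc (Suc k)) (g v) = c (Suc k) v - h (\<phi> (Suc k) v))"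
    proof (rule std.graded_map_lift[of _ _ "\<delta> (Suc k)"])
      show "std_map (b (Suc (Suc k))) (\<delta> (Suc (Suc k))) (\<delta> (Suc k)) (\<phi> (Suc (Suc k)))"
        using R by (simp add: graded_free_resolution_iff)
      have "std_map (b (Suc k)) (\<delta> (Suc k)) (\<delta> (Suc k)) (\<lambda>v. h (\<phi> (Suc k) v))"
        by (rule graded_map_compose[of _ _ _ "\<delta> k" _ "b k"])
           (use R h resolution_boundary[OF R] in \<open>auto simp: graded_free_resolution_iff P_def\<close>)
      then show "std_map (b (Suc k)) (\<delta> (Suc k)) (\<delta> (Suc k)) (\<lambda>v. c (Suc k) v - h (\<phi> (Suc k) v))"
        by (intro graded_map_diff c)
      show "(\<lambda>v. c (Suc k) v - h (\<phi> (Suc k) v)) ` free_module (b (Suc k))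
              \<subseteq> \<phi> (Suc (Suc k)) ` free_module (b (Suc (Suc k)))"
      proof safe
        fix v :: "('n, 'k) fvec" assume v: "v \<in> free_module (b (Suc k))"
        note b = resolution_boundary[OF R v]
        show "c (Suc k) v - h (\<phi> (Suc k) v) \<in> \<phi> (Suc (Suc k)) ` free_module (b (Suc (Suc k)))"
        proof (rule resolution_exact[OF R])
          show "c (Suc k) v - h (\<phi> (Suc k) v) \<in> free_module (b (Suc k))"
            using h c(2)[of "Suc k"] v b
            by (intro pm.subspace_diff subspace_free_module) (auto simp: P_def)
          show "\<phi> (Suc k) (c (Suc k) v - h (\<phi> (Suc k) v)) = 0"
            using h b by (simp add: \<phi>.diff cS[OF v] P_def)
        qed
      qed
    qed
    then show "\<exists>g. P (Suc k) g \<and> Q k h g"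
      unfolding P_def Q_def by auto
  qed
  then obtain h where "\<And>k. P k (h k)" "\<And>k. Q k (h k) (h (Suc k))" by blast
  then show ?thesis unfolding P_def Q_def by blast
qed

section \<open>Functoriality of tensoring with the residue field\<close>

section \<open>Reduction modulo the variables\<close>

lemma pp_add_eq_0_iff: "m + m' = 0 \<longleftrightarrow> m = 0 \<and> m' = (0 :: 'n pp)"
  by (auto simp: poly_mapping_eq_iff lookup_add fun_eq_iff)

text \<open>Two power products multiply to 1 only when both are 1. Hence taking constant terms is a
  ring homomorphism from P to K.\<close>

lemma lookup_mult_0:
  fixes p q :: "('n, 'k::comm_ring_1) mpoly"
  shows "lookup (p * q) 0 = lookup p 0 * lookup q 0"
proof -
  have "lookup (p * q) 0 = (\<Sum>l. lookup p l * (\<Sum>m. (lookup q m when l = 0) when m = 0))"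
    unfolding lookup_mult
    by (rule Sum_any.cong, rule arg_cong[where f = "(*) _"], rule Sum_any.cong)
      (auto simp: when_def pp_add_eq_0_iff eq_commute[of 0])
  also have "\<dots> = (\<Sum>l. (lookup p l * lookup q 0) when l = 0)"
    by (simp add: mult_when)
  finally show ?thesis by simp
qed

definition const_vec :: "('n, 'k::zero) fvec \<Rightarrow> (nat \<Rightarrow>\<^sub>0 'k)" where
  "const_vec v = Poly_Mapping.map (\<lambda>p. lookup p 0) v"

definition vec_const :: "(nat \<Rightarrow>\<^sub>0 'k::zero) \<Rightarrow> ('n, 'k) fvec" where
  "vec_const c = Poly_Mapping.map (single 0) c"

lemma lookup_const_vec [simp]: "lookup (const_vec v) i = lookup (lookup v i) 0"
  by (simp add: const_vec_def Poly_Mapping.map.rep_eq when_def)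

lemma lookup_vec_const [simp]: "lookup (vec_const c) i = single 0 (lookup c i)"
  by (simp add: vec_const_def Poly_Mapping.map.rep_eq when_def)

lemma tensor_map_eq: "tensor_map f c = const_vec (f (vec_const c))"
  by (simp add: tensor_map_def const_vec_def vec_const_def)

lemma in_free_module_bound: "\<exists>b. v \<in> free_module b"
proof -
  have "\<forall>j\<in>keys v. j < Suc (Max (insert 0 (keys v)))"
    by (simp add: le_imp_less_Suc)
  then show ?thesis unfolding free_module_def by blast
qed

lemma const_vec_linear_image:
  fixes f :: "('n, 'k::comm_ring_1) fvec \<Rightarrow> ('n, 'k) fvec"
  assumes "is_linear f" "v \<in> free_module b"
  shows "lookup (const_vec (f v)) i =
    (\<Sum>j<b. lookup (lookup v j) 0 * lookup (lookup (f (single j 1)) i) 0)"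
  unfolding lookup_const_vec is_linear_eq_lin_ext[OF assms] lin_ext_def
  by (simp add: lookup_sum lookup_mult_0)

lemma vec_const_in_free_module: "c \<in> free_module b \<Longrightarrow> vec_const c \<in> free_module b"
  by (simp add: free_module_iff)

lemma lookup_tensor_map:
  fixes f :: "('n, 'k::field) fvec \<Rightarrow> ('n, 'k) fvec"
  assumes "is_linear f" "c \<in> free_module b"
  shows "lookup (tensor_map f c) i = (\<Sum>j<b. lookup c j * lookup (lookup (f (single j 1)) i) 0)"
  unfolding tensor_map_eq const_vec_linear_image[OF assms(1) vec_const_in_free_module[OF assms(2)]]
  by simp

text \<open>The lift by constants inside \<open>tensor_map\<close> may be replaced by any other
  lift, because constant terms are multiplicative. Compatibility with composition follows from
  this.\<close>

lemma const_vec_linear: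
  fixes f :: "('n, 'k::field) fvec \<Rightarrow> ('n, 'k) fvec"
  assumes "is_linear f"
  shows "const_vec (f v) = tensor_map f (const_vec v)"
proof (rule poly_mapping_eqI)
  fix i
  obtain b where b: "v \<in> free_module b" using in_free_module_bound by blast
  then have "const_vec v \<in> free_module b" by (simp add: free_module_iff)
  with b show "lookup (const_vec (f v)) i = lookup (tensor_map f (const_vec v)) i"
    unfolding const_vec_linear_image[OF assms b] by (simp add: lookup_tensor_map[OF assms])
qed

lemma is_linear_tensor_map:
  fixes f :: "('n, 'k::field) fvec \<Rightarrow> ('n, 'k) fvec"
  assumes "is_linear f"
  shows "is_linear (tensor_map f)"
proof -
  interpret module_hom pscale pscale f by fact
  have 1: "vec_const (x + y) = vec_const x + (vec_const y :: ('n, 'k) fvec)" for x y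
    by (rule poly_mapping_eqI) (simp add: lookup_add single_add)
  have 2: "vec_const (pscale a x) = pscale (single 0 a) (vec_const x :: ('n, 'k) fvec)" for a x
    by (rule poly_mapping_eqI) (simp add: mult_single)
  have 3: "const_vec (x + y) = const_vec x + const_vec y" for x y :: "('n, 'k) fvec"
    by (rule poly_mapping_eqI) (simp add: lookup_add)
  have 4: "const_vec (pscale (single 0 a) x) = pscale a (const_vec x)" for a and x :: "('n, 'k) fvec"
    by (rule poly_mapping_eqI) (simp add: lookup_mult_0)
  show ?thesis by (simp add: is_linear_iff tensor_map_eq 1 2 3 4 add scale)
qed

lemma tensor_map_compose:
  assumes "is_linear f" "is_linear g"
  shows "tensor_map (\<lambda>v. g (f v)) c = tensor_map g (tensor_map f c)"
  by (simp add: tensor_map_eq[of "\<lambda>v. g (f v)"] tensor_map_eq[of f] const_vec_linear[OF assms(2)])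

lemma tensor_map_diff:
  "tensor_map (\<lambda>v. f v - g v) c = tensor_map f c - tensor_map g c"
  by (rule poly_mapping_eqI) (simp add: tensor_map_eq lookup_minus)

lemma tensor_map_cong:
  assumes "\<And>v. v \<in> free_module b \<Longrightarrow> f v = g v" "c \<in> tensor_component b \<delta> d"
  shows "tensor_map f c = tensor_map g c"
proof -
  have "c \<in> free_module b" using assms(2) by (auto simp: tensor_component_def free_module_def)
  then show ?thesis by (simp add: tensor_map_eq assms(1) vec_const_in_free_module)
qed

lemma tensor_map_commute:
  fixes f g f' g' :: "('n, 'k::field) fvec \<Rightarrow> ('n, 'k) fvec"
  assumes "is_linear f" "is_linear g" "is_linear f'" "is_linear g'"
    and "\<And>v. v \<in> free_module b \<Longrightarrow> g (f v) = g' (f' v)" "c \<in> tensor_component b \<delta> d"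
  shows "tensor_map g (tensor_map f c) = tensor_map g' (tensor_map f' c)"
  unfolding tensor_map_compose[OF assms(1,2), symmetric] tensor_map_compose[OF assms(3,4), symmetric]
  by (rule tensor_map_cong[OF assms(5,6)])

lemma tensor_component_subset: "tensor_component b \<delta> d \<subseteq> free_module b"
  by (auto simp: tensor_component_def free_module_def)

lemma tensor_component_iff:
  "c \<in> tensor_component b \<delta> d \<longleftrightarrow> (\<forall>j. lookup c j \<noteq> 0 \<longrightarrow> j < b \<and> \<delta> j = d)"
  by (auto simp: tensor_component_def in_keys_iff)

lemma subspace_tensor_component:
  "pm.subspace (tensor_component b \<delta> d :: (nat \<Rightarrow>\<^sub>0 'k::field) set)"
  by (rule pm.subspaceI) (auto simp: tensor_component_iff lookup_add, (metis add_0)+)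

lemma tensor_component_finite_dim:
  "tensor_component b \<delta> d \<subseteq> pm.span ((\<lambda>j. single j (1::'k::field)) ` {..<b})"
proof
  fix c :: "nat \<Rightarrow>\<^sub>0 'k" assume "c \<in> tensor_component b \<delta> d"
  then have "c = (\<Sum>j<b. pscale (lookup c j) (single j 1))"
    using tensor_component_subset by (intro free_module_expand) auto
  also have "\<dots> \<in> pm.span ((\<lambda>j. single j 1) ` {..<b})"
    by (intro pm.span_sum pm.span_scale pm.span_base) auto
  finally show "c \<in> pm.span ((\<lambda>j. single j 1) ` {..<b})" .
qed

text \<open>Constants have weight 0, so a vector over K in degree \<open>d\<close> lifts to a
  homogeneous vector over P of degree \<open>d\<close>; its image can have a nonzero constant term
  only at a basis element of degree \<open>d\<close>.\<close>

lemma tensor_map_component: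
  assumes f: "std_map b \<delta> \<delta>' f" "f ` free_module b \<subseteq> free_module b'"
    and c: "c \<in> tensor_component b \<delta> d"
  shows "tensor_map f c \<in> tensor_component b' \<delta>' d"
proof -
  have "vec_const c \<in> free_module b"
    using c tensor_component_subset by (blast intro: vec_const_in_free_module)
  moreover have "std_homogeneous \<delta> d (vec_const c)"
    using c by (auto simp: homogeneous_iff tensor_component_iff lookup_single when_def tdeg_zero
        split: if_splits)
  ultimately have "f (vec_const c) \<in> free_module b'" "std_homogeneous \<delta>' d (f (vec_const c))"
    using f by (auto simp: graded_map_def)
  then show ?thesis
    by (force simp: tensor_component_iff tensor_map_eq free_module_iff homogeneous_iff tdeg_zero
        not_le[symmetric])
qed

section \<open>Dimensions of homology under homotopy equivalence\<close>

section \<open>Independence of Tor from the resolution\<close>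

text \<open>When an element of one set depends on the rest, the contribution of the other set lies
  in both spans and so is zero; what remains contradicts independence of the first set
  alone.\<close>

lemma (in vector_space) independent_Un:
  assumes A: "independent A" and B: "independent B" and AB: "span A \<inter> span B \<subseteq> {0}"
  shows "independent (A \<union> B)"
proof
  assume "dependent (A \<union> B)"
  then obtain a where a: "a \<in> A \<union> B" "a \<in> span (A \<union> B - {a})" by (auto simp: dependent_def)
  have *: False
    if C: "independent C" "a \<in> C" "span C \<inter> span D \<subseteq> {0}" "a \<in> span ((C - {a}) \<union> D)" for C D
  proof -
    obtain x y where xy: "x \<in> span (C - {a})" "y \<in> span D" "a = x + y"
      using C(4) by (auto simp: span_Un)
    have x: "x \<in> span C" using xy(1) span_mono[of "C - {a}" C] by blast
    then have "y \<in> span C" using span_diff[OF span_base[OF C(2)] x] xy(3) by simp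
    then have "y = 0" using C(3) xy(2) by auto
    then have "a \<in> span (C - {a})" using xy by simp
    with C show False by (auto simp: dependent_def)
  qed
  from a(1) show False
  proof
    assume "a \<in> A"
    then show False
      by (intro *[of A B]) (use A AB a(2) span_mono[of "A \<union> B - {a}" "(A - {a}) \<union> B"] in auto)
  next
    assume "a \<in> B"
    then show False
      by (intro *[of B A]) (use B AB a(2) span_mono[of "A \<union> B - {a}" "(B - {a}) \<union> A"] in auto)
  qed
qed

text \<open>The induced map from Z/B to Z'/B' is injective by \<open>inj\<close>. Quotient spaces
  are avoided: a basis of \<open>B\<close> is extended to one of \<open>Z\<close>, and the images of
  the added vectors \<open>C\<close> are independent together with a basis of
  \<open>B'\<close>.\<close>

lemma (in vector_space_pair) dim_quotient_le:
  assumes f: "module_hom s1 s2 f" and Z: "vs1.subspace Z" and B: "vs1.subspace B" "B \<subseteq> Z"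
    and Z': "f ` Z \<subseteq> Z'" and B': "vs2.subspace B'" "B' \<subseteq> Z'"
    and inj: "\<And>z. z \<in> Z \<Longrightarrow> f z \<in> B' \<Longrightarrow> z \<in> B"
    and fin: "finite W" "Z \<subseteq> vs1.span W" "finite W'" "Z' \<subseteq> vs2.span W'"
  shows "vs1.dim Z - vs1.dim B \<le> vs2.dim Z' - vs2.dim B'"
proof -
  interpret f: module_hom s1 s2 f by fact
  obtain E where E: "E \<subseteq> B" "vs1.independent E" "B \<subseteq> vs1.span E" "card E = vs1.dim B"
    by (rule vs1.basis_exists)
  obtain A where A: "E \<subseteq> A" "A \<subseteq> Z" "vs1.independent A" "Z \<subseteq> vs1.span A"
    using E B(2) by (metis vs1.maximal_independent_subset_extend subset_trans)
  have finA: "finite A"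
    using vs1.independent_span_bound[OF fin(1) A(3)] A(2) fin(2) by blast
  define C where "C = A - E"
  have dimZ: "vs1.dim Z = card A" using vs1.basis_card_eq_dim[OF A(2,4,3)] by simp
  \<comment> \<open>\<open>E\<close> is contained in the finite set \<open>A\<close>, so the
    subtraction of naturals is exact.\<close>
  have dC: "vs1.dim Z - vs1.dim B = card C"
    unfolding C_def dimZ E(4)[symmetric] using A(1) finA finite_subset by (metis card_Diff_subset)
  obtain E' where E': "E' \<subseteq> B'" "vs2.independent E'" "B' \<subseteq> vs2.span E'" "card E' = vs2.dim B'"
    by (rule vs2.basis_exists)
  have spanC: "vs1.span C \<subseteq> Z" using A Z by (intro vs1.span_minimal) (auto simp: C_def)
  \<comment> \<open>\<open>E\<close> and \<open>C\<close> are disjoint parts of the basis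
    \<open>A\<close>; the coordinates of a vector in both spans are supported in each part, so all
    of them vanish.\<close>
  have CB: "x = 0" if x: "x \<in> vs1.span C" "x \<in> B" for x
  proof (rule ccontr)
    assume "x \<noteq> 0"
    let ?r = "vs1.representation A x"
    have C: "C \<subseteq> A" by (auto simp: C_def)
    have "x \<in> vs1.span E" using x E by auto
    then have "vs1.representation A x = vs1.representation E x"
      by (rule vs1.representation_extend[OF A(3) _ A(1)])
    moreover have "vs1.representation A x = vs1.representation C x"
      by (rule vs1.representation_extend[OF A(3) x(1) C])
    moreover have "vs1.representation E x v \<noteq> 0 \<Longrightarrow> v \<in> E" "vs1.representation C x v \<noteq> 0 \<Longrightarrow> v \<in> C" for v
      by (rule vs1.representation_ne_zero, assumption)+
    ultimately have "?r v = 0" for v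
      unfolding C_def by (metis DiffD2)
    moreover have "(\<Sum>v | ?r v \<noteq> 0. s1 (?r v) v) = x"
      using A x spanC by (intro vs1.sum_nonzero_representation_eq) auto
    ultimately show False using \<open>x \<noteq> 0\<close> by simp
  qed
  have kerC: "x = 0" if "x \<in> vs1.span C" "f x \<in> B'" for x
    using that CB inj spanC by blast
  have injC: "inj_on f (vs1.span C)"
    using kerC vs2.subspace_0[OF B'(1)] by (auto simp: f.inj_on_iff_eq_0[OF vs1.subspace_span])
  have indC: "vs2.independent (f ` C)"
    by (rule f.independent_injective_image[OF vs1.independent_mono[OF A(3)] injC]) (auto simp: C_def)
  have EB: "vs2.span E' \<subseteq> B'" using E' B' by (intro vs2.span_minimal) auto
  have int: "vs2.span E' \<inter> vs2.span (f ` C) \<subseteq> {0}"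
  proof
    fix y assume y: "y \<in> vs2.span E' \<inter> vs2.span (f ` C)"
    then obtain x where "x \<in> vs1.span C" "y = f x" unfolding f.span_image by blast
    with y EB have "x = 0" by (intro kerC) auto
    with \<open>y = f x\<close> show "y \<in> {0}" by simp
  qed
  have ind: "vs2.independent (E' \<union> f ` C)"
    by (rule vs2.independent_Un[OF E'(2) indC int])
  have "f ` C \<subseteq> f ` Z" using A(2) unfolding C_def by blast
  then have sub: "E' \<union> f ` C \<subseteq> Z'" using E'(1) B'(2) Z' by blast
  obtain A' where A': "E' \<union> f ` C \<subseteq> A'" "A' \<subseteq> Z'" "vs2.independent A'" "Z' \<subseteq> vs2.span A'"
    by (rule vs2.maximal_independent_subset_extend[OF sub ind])
  have finA': "finite A'"
    using vs2.independent_span_bound[OF fin(3) A'(3)] A'(2) fin(4) by blast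
  have "E' \<inter> f ` C = {}"
  proof (rule equals0I)
    fix x assume x: "x \<in> E' \<inter> f ` C"
    then have "x \<in> vs2.span E'" "x \<in> vs2.span (f ` C)" by (simp_all add: vs2.span_base)
    with int have "x = 0" by auto
    with x have "0 \<in> E'" by simp
    with E'(2) show False using vs2.dependent_zero by blast
  qed
  then have "card E' + card C = card (E' \<union> f ` C)"
    using finA' A'(1) card_image[OF inj_on_subset[OF injC vs1.span_superset]]
    by (subst card_Un_disjoint) (auto intro: finite_subset)
  also have "\<dots> \<le> vs2.dim Z'"
    using card_mono[OF finA' A'(1)] vs2.basis_card_eq_dim[OF A'(2,4,3)] by simp
  finally show ?thesis using dC E'(4) by simp
qed

text \<open>The chain map \<open>f\<close> is injective on homology because \<open>g\<close> after
  \<open>f\<close> is homotopic to the identity. One inequality is enough, as the two resolutions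
  may be exchanged.\<close>

lemma tor_dim_le:
  fixes \<phi> :: "nat \<Rightarrow> ('n::finite, 'k::field) fvec \<Rightarrow> ('n, 'k) fvec"
  assumes R: "graded_free_resolution ds M b \<delta> \<phi>" and R': "graded_free_resolution ds M b' \<delta>' \<phi>'"
  shows "tor_dim b \<delta> \<phi> k d \<le> tor_dim b' \<delta>' \<phi>' k d"
proof -
  obtain f g where f: "chain_map b \<delta> \<phi> b' \<delta>' \<phi>' f" and g: "chain_map b' \<delta>' \<phi>' b \<delta> \<phi> g"
    using chain_map_exists[OF R R'] chain_map_exists[OF R' R] by blast
  have lin: "is_linear (\<phi> j)" "is_linear (\<phi>' j)" "is_linear (f j)" "is_linear (g j)" for j
    using R R' f g by (simp_all add: graded_free_resolution_def chain_map_def graded_map_def)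
  have gr: "std_map (b j) (\<delta> j) (\<delta>' j) (f j)" "std_map (b' j) (\<delta>' j) (\<delta> j) (g j)"
    "f j ` free_module (b j) \<subseteq> free_module (b' j)" "g j ` free_module (b' j) \<subseteq> free_module (b j)" for j
    using f g by (simp_all add: chain_map_def)
  have fm: "f j v \<in> free_module (b' j)" if "v \<in> free_module (b j)" for j v
    using gr(3)[of j] that by blast
  have gm: "g j v \<in> free_module (b j)" if "v \<in> free_module (b' j)" for j v
    using gr(4)[of j] that by blast
  have com: "\<phi>' (Suc j) (f (Suc j) v) = f j (\<phi> (Suc j) v)" if "v \<in> free_module (b (Suc j))" for j v
    using f that by (simp add: chain_map_def)
  have com': "\<phi> (Suc j) (g (Suc j) v) = g j (\<phi>' (Suc j) v)" if "v \<in> free_module (b' (Suc j))" for j v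
    using g that by (simp add: chain_map_def)
  have "\<exists>h. (\<forall>k. std_map (b k) (\<delta> k) (\<delta> (Suc k)) (h k) \<and>
                  h k ` free_module (b k) \<subseteq> free_module (b (Suc k))) \<and>
             (\<forall>v\<in>free_module (b 0). \<phi> (Suc 0) (h 0 v) = v - g 0 (f 0 v)) \<and>
             (\<forall>k. \<forall>v\<in>free_module (b (Suc k)).
                \<phi> (Suc (Suc k)) (h (Suc k) v) = (v - g (Suc k) (f (Suc k) v)) - h k (\<phi> (Suc k) v))"
  proof (rule null_homotopy_exists[OF R])
    fix j
    show "std_map (b j) (\<delta> j) (\<delta> j) (\<lambda>v. v - g j (f j v))"
      by (rule graded_map_diff[OF graded_map_ident graded_map_compose[OF gr(1,2,3)]])
    show "(\<lambda>v. v - g j (f j v)) ` free_module (b j) \<subseteq> free_module (b j)"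
      by (auto intro!: pm.subspace_diff subspace_free_module gm fm)
    show "\<phi> (Suc j) (v - g (Suc j) (f (Suc j) v)) = \<phi> (Suc j) v - g j (f j (\<phi> (Suc j) v))"
      if "v \<in> free_module (b (Suc j))" for v
      using that by (simp add: module_hom.diff[OF lin(1)] com com' fm)
  next
    fix v :: "('n, 'k) fvec" assume v: "v \<in> free_module (b 0)"
    have "\<phi> 0 (g 0 (f 0 v)) = \<phi> 0 v"
      using f g fm[OF v] v by (simp add: chain_map_def)
    then show "\<phi> 0 (v - g 0 (f 0 v)) = 0"
      by (simp add: module_hom.diff[OF lin(1)])
  qed
  then obtain h where H: "(\<forall>k. std_map (b k) (\<delta> k) (\<delta> (Suc k)) (h k) \<and>
                  h k ` free_module (b k) \<subseteq> free_module (b (Suc k))) \<and>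
             (\<forall>v\<in>free_module (b 0). \<phi> (Suc 0) (h 0 v) = v - g 0 (f 0 v)) \<and>
             (\<forall>k. \<forall>v\<in>free_module (b (Suc k)).
                \<phi> (Suc (Suc k)) (h (Suc k) v) = (v - g (Suc k) (f (Suc k) v)) - h k (\<phi> (Suc k) v))" ..
  have h: "std_map (b j) (\<delta> j) (\<delta> (Suc j)) (h j)" "h j ` free_module (b j) \<subseteq> free_module (b (Suc j))" for j
    using H by simp_all
  have h0: "\<phi> (Suc 0) (h 0 v) = v - g 0 (f 0 v)" if "v \<in> free_module (b 0)" for v
    using H that by simp
  have hS: "\<phi> (Suc (Suc j)) (h (Suc j) v) = (v - g (Suc j) (f (Suc j) v)) - h j (\<phi> (Suc j) v)"
    if "v \<in> free_module (b (Suc j))" for j v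
    using H that by simp
  have linh: "is_linear (h j)" for j using h(1) by (rule graded_map_linear)
  let ?T = "\<lambda>j. tensor_component (b j) (\<delta> j) d" and ?T' = "\<lambda>j. tensor_component (b' j) (\<delta>' j) d"
  let ?Z = "{c \<in> ?T k. k = 0 \<or> tensor_map (\<phi> k) c = 0}"
  let ?Z' = "{c \<in> ?T' k. k = 0 \<or> tensor_map (\<phi>' k) c = 0}"
  let ?B = "tensor_map (\<phi> (Suc k)) ` ?T (Suc k)"
  let ?B' = "tensor_map (\<phi>' (Suc k)) ` ?T' (Suc k)"
  have T: "tensor_map (f j) c \<in> ?T' j" if "c \<in> ?T j" for c j
    by (rule tensor_map_component[OF gr(1,3) that])
  have T': "tensor_map (g j) c \<in> ?T j" if "c \<in> ?T' j" for c j
    by (rule tensor_map_component[OF gr(2,4) that])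
  have Th: "tensor_map (h j) c \<in> ?T (Suc j)" if "c \<in> ?T j" for c j
    by (rule tensor_map_component[OF h(1,2) that])
  have ft: "tensor_map (\<phi>' (Suc j)) (tensor_map (f (Suc j)) c) = tensor_map (f j) (tensor_map (\<phi> (Suc j)) c)"
    if "c \<in> ?T (Suc j)" for j c
    by (rule tensor_map_commute[OF lin(3,2,1,3) com that])
  have gt: "tensor_map (\<phi> (Suc j)) (tensor_map (g (Suc j)) c) = tensor_map (g j) (tensor_map (\<phi>' (Suc j)) c)"
    if "c \<in> ?T' (Suc j)" for j c
    by (rule tensor_map_commute[OF lin(4,1,2,4) com' that])
  \<comment> \<open>After reduction, the term of the homotopy identity that passes through
    \<open>h j\<close> vanishes on cycles. For \<open>k = 0\<close> there is no such term, which
    matches leaving the augmentation out of the complex.\<close>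
  have homotopy: "z - tensor_map (g k) (tensor_map (f k) z) = tensor_map (\<phi> (Suc k)) (tensor_map (h k) z)"
    if z: "z \<in> ?Z" for z
  proof -
    have zT: "z \<in> ?T k" using z by simp
    have id: "tensor_map (\<lambda>v :: ('n, 'k) fvec. v) z = z"
      by (rule poly_mapping_eqI) (simp add: tensor_map_eq)
    have gf: "tensor_map (\<lambda>v. v - g k (f k v)) z = z - tensor_map (g k) (tensor_map (f k) z)"
      by (simp add: tensor_map_diff id tensor_map_compose[OF lin(3,4)])
    show ?thesis
    proof (cases k)
      case 0
      have "tensor_map (\<lambda>v. v - g k (f k v)) z = tensor_map (\<lambda>v. \<phi> (Suc k) (h k v)) z"
        by (rule tensor_map_cong[OF _ zT]) (simp add: 0 h0)
      then show ?thesis by (simp add: gf tensor_map_compose[OF linh lin(1)])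
    next
      case (Suc j)
      have "tensor_map (\<lambda>v. (v - g k (f k v)) - h j (\<phi> k v)) z = tensor_map (\<lambda>v. \<phi> (Suc k) (h k v)) z"
        by (rule tensor_map_cong[OF _ zT]) (simp add: Suc hS)
      moreover have "tensor_map (h j) (tensor_map (\<phi> k) z) = 0"
        using z Suc module_hom.zero[OF is_linear_tensor_map[OF linh]] by simp
      ultimately show ?thesis
        by (simp add: gf tensor_map_diff[of "\<lambda>v. v - g k (f k v)"] tensor_map_compose linh lin)
    qed
  qed
  have sub: "pm.subspace (?T j :: (nat \<Rightarrow>\<^sub>0 'k) set)" "pm.subspace (?T' j :: (nat \<Rightarrow>\<^sub>0 'k) set)" for j
    by (simp_all add: subspace_tensor_component)
  have subZ: "pm.subspace {c \<in> tensor_component m \<epsilon> d. k = 0 \<or> tensor_map u c = 0}"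
    if "is_linear u" for m \<epsilon> and u :: "('n, 'k) fvec \<Rightarrow> ('n, 'k) fvec"
    using pm.subspace_inter[OF subspace_tensor_component
        module_hom.subspace_kernel[OF is_linear_tensor_map[OF that]]]
    by (cases "k = 0") (auto simp: subspace_tensor_component Collect_conj_eq)
  have BZ: "tensor_map (\<psi> (Suc k)) ` tensor_component (c (Suc k)) (\<epsilon> (Suc k)) d
      \<subseteq> {x \<in> tensor_component (c k) (\<epsilon> k) d. k = 0 \<or> tensor_map (\<psi> k) x = 0}"
    if S: "graded_free_resolution ds M c \<epsilon> \<psi>" for c \<epsilon> and \<psi> :: "nat \<Rightarrow> ('n, 'k) fvec \<Rightarrow> ('n, 'k) fvec"
  proof -
    have l: "is_linear (\<psi> j)" for j using S by (simp add: graded_free_resolution_def)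
    have "tensor_map (\<psi> k) (tensor_map (\<psi> (Suc k)) x) = 0"
      if "x \<in> tensor_component (c (Suc k)) (\<epsilon> (Suc k)) d" for x
    proof -
      have "tensor_map (\<psi> k) (tensor_map (\<psi> (Suc k)) x) = tensor_map (\<lambda>v. 0 :: ('n, 'k) fvec) x"
        unfolding tensor_map_compose[OF l l, symmetric]
        by (rule tensor_map_cong[OF _ that]) (rule resolution_boundary(2)[OF S])
      also have "\<dots> = 0" by (rule poly_mapping_eqI) (simp add: tensor_map_eq)
      finally show ?thesis .
    qed
    moreover have "tensor_map (\<psi> (Suc k)) x \<in> tensor_component (c k) (\<epsilon> k) d"
      if "x \<in> tensor_component (c (Suc k)) (\<epsilon> (Suc k)) d" for x
      by (rule tensor_map_component[OF _ _ that])
        (use S resolution_boundary[OF S] in \<open>auto simp: graded_free_resolution_iff\<close>)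
    ultimately show ?thesis by auto
  qed
  have "pv.dim ?Z - pv.dim ?B \<le> pv.dim ?Z' - pv.dim ?B'"
  proof (rule vector_space_pair.dim_quotient_le)
    show "vector_space_pair (pscale :: 'k \<Rightarrow> (nat \<Rightarrow>\<^sub>0 'k) \<Rightarrow> _) (pscale :: 'k \<Rightarrow> (nat \<Rightarrow>\<^sub>0 'k) \<Rightarrow> _)"
      by unfold_locales
    show "is_linear (tensor_map (f k))" by (rule is_linear_tensor_map[OF lin(3)])
    show "pm.subspace ?Z" by (rule subZ[OF lin(1)])
    show "pm.subspace ?B"
      by (rule module_hom.subspace_image[OF is_linear_tensor_map[OF lin(1)] sub(1)])
    show "pm.subspace ?B'"
      by (rule module_hom.subspace_image[OF is_linear_tensor_map[OF lin(2)] sub(2)])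
    show "?B \<subseteq> ?Z" "?B' \<subseteq> ?Z'" by (rule BZ[OF R], rule BZ[OF R'])
    show "tensor_map (f k) ` ?Z \<subseteq> ?Z'"
    proof (cases k)
      case (Suc j)
      have "tensor_map (\<phi>' k) (tensor_map (f k) c) = 0" if "c \<in> ?Z" for c
        using that ft[of c j] module_hom.zero[OF is_linear_tensor_map[OF lin(3)]] by (simp add: Suc)
      with T show ?thesis by auto
    qed (use T in auto)
    \<comment> \<open>If the image of \<open>z\<close> is the boundary of \<open>y\<close>, the
      homotopy exhibits \<open>z\<close> as the boundary of the reduced \<open>h k\<close> applied
      to \<open>z\<close> plus the reduced \<open>g (Suc k)\<close> applied to
      \<open>y\<close>.\<close>
    show "z \<in> ?B" if z: "z \<in> ?Z" and fz: "tensor_map (f k) z \<in> ?B'" for z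
    proof -
      obtain y where y: "y \<in> ?T' (Suc k)" "tensor_map (f k) z = tensor_map (\<phi>' (Suc k)) y"
        using fz by blast
      interpret \<phi>: module_hom pscale pscale "tensor_map (\<phi> (Suc k))"
        by (rule is_linear_tensor_map[OF lin(1)])
      have "z = tensor_map (\<phi> (Suc k)) (tensor_map (h k) z) + tensor_map (g k) (tensor_map (f k) z)"
        using homotopy[OF z] by (metis diff_add_cancel)
      also have "\<dots> = tensor_map (\<phi> (Suc k)) (tensor_map (h k) z + tensor_map (g (Suc k)) y)"
        by (simp add: y(2) gt[OF y(1)] \<phi>.add)
      also have "\<dots> \<in> ?B"
        using z Th T' y(1) by (intro imageI pm.subspace_add sub) auto
      finally show ?thesis .
    qed
    show "finite ((\<lambda>j. single j (1::'k)) ` {..<b k})" "finite ((\<lambda>j. single j (1::'k)) ` {..<b' k})"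
      by simp_all
    show "?Z \<subseteq> pm.span ((\<lambda>j. single j (1::'k)) ` {..<b k})"
      using tensor_component_finite_dim[of "b k" "\<delta> k" d] by blast
    show "?Z' \<subseteq> pm.span ((\<lambda>j. single j (1::'k)) ` {..<b' k})"
      using tensor_component_finite_dim[of "b' k" "\<delta>' k" d] by blast
  qed
  then show ?thesis unfolding tor_dim_def .
qed

text \<open>The given resolution guarantees that the triple picked by \<open>SOME\<close> really is
  a resolution; the two are then compared in both directions.\<close>

theorem betti_eq_tor_dim:
  assumes R: "graded_free_resolution ds M b \<delta> \<phi>"
  shows "betti ds M k d = tor_dim b \<delta> \<phi> k d"
proof -
  obtain b' \<delta>' \<phi>' where c: "(SOME (b, \<delta>, \<phi>). graded_free_resolution ds M b \<delta> \<phi>) = (b', \<delta>', \<phi>')"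
    by (metis prod_cases3)
  have "(\<lambda>(b, \<delta>, \<phi>). graded_free_resolution ds M b \<delta> \<phi>) (SOME (b, \<delta>, \<phi>). graded_free_resolution ds M b \<delta> \<phi>)"
    by (rule someI[of _ "(b, \<delta>, \<phi>)"]) (simp add: R)
  then have "graded_free_resolution ds M b' \<delta>' \<phi>'" by (simp add: c)
  then show ?thesis
    unfolding betti_def c using tor_dim_le[OF R, of b' \<delta>' \<phi>' k d] tor_dim_le[of ds M b' \<delta>' \<phi>' b \<delta> \<phi> k d] R
    by (simp add: le_antisym)
qed

section \<open>Dickson's lemma, finite generation and multigraded free resolutions\<close>

section \<open>Multigraded resolutions\<close>

text \<open>A decreasing sequence of naturals attains its minimum and is constant from there on, so
  in that case a tail serves.\<close>

lemma nat_seq_incseq_subseq: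
  fixes f :: "nat \<Rightarrow> nat"
  shows "\<exists>g. strict_mono g \<and> incseq (\<lambda>i. f (g i))"
proof -
  obtain g where g: "strict_mono g" "monoseq (\<lambda>i. f (g i))"
    using seq_monosub[of f] by blast
  show ?thesis
  proof (cases "incseq (\<lambda>i. f (g i))")
    case False
    then have dec: "decseq (\<lambda>i. f (g i))" using g(2) by (auto simp: monoseq_iff)
    obtain N where N: "\<And>i. f (g N) \<le> f (g i)"
      using ex_has_least_nat[of "\<lambda>_. True" 0 "\<lambda>i. f (g i)"] by auto
    have "f (g (N + i)) = f (g N)" for i
      using N[of "N + i"] decseqD[OF dec, of N "N + i"] by simp
    moreover have "strict_mono (\<lambda>i. g (N + i))"
      using g(1) by (simp add: strict_mono_def)
    ultimately show ?thesis by (intro exI[of _ "\<lambda>i. g (N + i)"]) (simp add: incseq_def)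
  qed (use g in blast)
qed

text \<open>Subsequences are refined one variable at a time; passing to a further subsequence keeps
  the monotonicity already achieved.\<close>

lemma pp_seq_incseq_subseq:
  fixes f :: "nat \<Rightarrow> 'n::finite pp"
  shows "\<exists>g. strict_mono g \<and> (\<forall>x. incseq (\<lambda>i. lookup (f (g i)) x))"
proof -
  have "\<exists>g. strict_mono g \<and> (\<forall>x\<in>X. incseq (\<lambda>i. lookup (f (g i)) x))" for X :: "'n set"
  proof (induction X rule: infinite_finite_induct)
    case (insert x X)
    then obtain g where g: "strict_mono g" "\<forall>x\<in>X. incseq (\<lambda>i. lookup (f (g i)) x)" by blast
    obtain h where h: "strict_mono h" "incseq (\<lambda>i. lookup (f (g (h i))) x)"
      using nat_seq_incseq_subseq[of "\<lambda>i. lookup (f (g i)) x"] by blast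
    have "strict_mono (\<lambda>i. g (h i))" using g(1) h(1) by (simp add: strict_mono_def)
    moreover have "incseq (\<lambda>i. lookup (f (g (h i))) y)" if "y \<in> X" for y
      using g(2) that h(1) by (auto simp: incseq_def strict_mono_less_eq)
    ultimately show ?case using h(2) by (intro exI[of _ "\<lambda>i. g (h i)"]) auto
  qed (auto intro: exI[of _ id] simp: strict_mono_def)
  from this[of UNIV] show ?thesis by simp
qed

text \<open>\<open>B\<close> consists of the elements minimal for divisibility. An infinite
  \<open>B\<close> would contain a sequence with increasing exponents, hence two distinct comparable
  minimal elements; descent in total degree finds a minimal divisor of any \<open>a\<close>.\<close>

lemma dickson:
  fixes S :: "'n::finite pp set"
  obtains B where "finite B" "B \<subseteq> S" "\<And>a. a \<in> S \<Longrightarrow> \<exists>b\<in>B. \<exists>c. a = c + b"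
proof
  define le where "le a b \<longleftrightarrow> (\<forall>x. lookup a x \<le> lookup b x)" for a b :: "'n pp"
  define B where "B = {b \<in> S. \<forall>a\<in>S. le a b \<longrightarrow> a = b}"
  show "B \<subseteq> S" by (auto simp: B_def)
  show "finite B"
  proof (rule ccontr)
    assume "infinite B"
    then obtain f :: "nat \<Rightarrow> 'n pp" where f: "inj f" "range f \<subseteq> B"
      using infinite_countable_subset by blast
    obtain g where g: "strict_mono g" "\<forall>x. incseq (\<lambda>i. lookup (f (g i)) x)"
      using pp_seq_incseq_subseq[of f] by blast
    have "le (f (g 0)) (f (g 1))" using g(2) by (simp add: le_def incseq_def)
    moreover have "f (g 0) \<in> B" "f (g 1) \<in> B" using f(2) by auto
    ultimately have "f (g 0) = f (g 1)" by (auto simp: B_def)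
    then have "g 0 = g 1" using f(1) by (simp add: inj_eq)
    then show False using strict_monoD[OF g(1), of 0 1] by simp
  qed
  show "\<exists>b\<in>B. \<exists>c. a = c + b" if "a \<in> S" for a
    using that
  proof (induction "tdeg a" arbitrary: a rule: less_induct)
    case less
    show ?case
    proof (cases "a \<in> B")
      case True
      then show ?thesis by (intro bexI[of _ a] exI[of _ 0]) simp_all
    next
      case False
      then obtain a' where a': "a' \<in> S" "le a' a" "a' \<noteq> a" using less.prems by (auto simp: B_def)
      have eq: "a = (a - a') + a'"
        using a'(2) by (intro poly_mapping_eqI) (simp add: lookup_add lookup_minus le_def)
      have "a - a' \<noteq> 0" using eq a'(3) by (metis add_0)
      then obtain x where "lookup (a - a') x \<noteq> 0" by (metis poly_mapping_eqI lookup_zero)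
      then have "0 < tdeg (a - a')" by (auto simp: tdeg_def intro!: sum_pos2[of _ x])
      then have "tdeg a' < tdeg a" using tdeg_add[of "a - a'" a'] eq by simp
      then obtain b c where "b \<in> B" "a' = c + b" using less.hyps a'(1) by blast
      then show ?thesis using eq by (intro bexI[of _ b] exI[of _ "(a - a') + c"]) (simp_all add: add.assoc)
    qed
  qed
qed

abbreviation fine_homogeneous ::
    "(nat \<Rightarrow> 'n pp) \<Rightarrow> 'n pp \<Rightarrow> ('n, 'k::zero) fvec \<Rightarrow> bool" where
  "fine_homogeneous \<equiv> homogeneous (\<lambda>m. m)"

abbreviation fine_map ::
    "nat \<Rightarrow> (nat \<Rightarrow> 'n pp) \<Rightarrow> (nat \<Rightarrow> 'n pp) \<Rightarrow> (('n, 'k::comm_ring_1) fvec \<Rightarrow> ('n, 'k) fvec) \<Rightarrow> bool" where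
  "fine_map \<equiv> graded_map (\<lambda>m. m)"

text \<open>The equation \<open>m + t i = a\<close> determines \<open>m\<close>, so a component
  holds at most one term. Both the reduction to finitely many generators and the formula for
  \<open>D\<close> on multiples rest on this.\<close>

lemma fine_homogeneous_lookup:
  assumes "fine_homogeneous t a v" "lookup v i \<noteq> 0"
  obtains m c where "lookup v i = single m c" "c \<noteq> 0" "m + t i = a"
proof -
  obtain m where m: "m \<in> keys (lookup v i)" using assms(2) by (metis keys_eq_empty ex_in_conv)
  have am: "m + t i = a" using assms m by (simp add: homogeneous_def)
  have "lookup (lookup v i) m' = 0" if "m' \<noteq> m" for m'
  proof (rule ccontr)
    assume "lookup (lookup v i) m' \<noteq> 0"
    then have "m' + t i = a" using assms by (simp add: homogeneous_iff)
    with am that show False by (metis add_right_cancel)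
  qed
  then have "lookup v i = single m (lookup (lookup v i) m)"
    by (intro poly_mapping_eqI) (simp add: lookup_single when_def)
  with am m that show ?thesis by (simp add: in_keys_iff)
qed

text \<open>Elements are sorted by their last nonzero component, and for each component Dickson's
  lemma leaves finitely many multidegrees to realise. Subtracting a term multiple of a suitable
  generator removes the last component of a given element.\<close>

lemma fine_graded_finitely_generated:
  fixes M :: "('n::finite, 'k::field) fvec set"
  assumes M: "graded_submodule (\<lambda>m. m) r t M"
  obtains G where "finite G" "G \<subseteq> M" "\<And>g. g \<in> G \<Longrightarrow> \<exists>a. fine_homogeneous t a g" "M = pm.span G"
proof -
  define A where "A i = {a. \<exists>v\<in>M. fine_homogeneous t a v \<and> v \<in> free_module (Suc i) \<and> lookup v i \<noteq> 0}" for i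
  have "\<exists>B. finite B \<and> B \<subseteq> A i \<and> (\<forall>a\<in>A i. \<exists>b\<in>B. \<exists>c. a = c + b)" for i
    by (rule dickson[of "A i"]) blast
  then obtain B where B: "\<And>i. finite (B i)" "\<And>i. B i \<subseteq> A i" "\<And>i. \<forall>a\<in>A i. \<exists>b\<in>B i. \<exists>c. a = c + b"
    by metis
  have "\<forall>i a. \<exists>v. a \<in> A i \<longrightarrow> v \<in> M \<and> fine_homogeneous t a v \<and> v \<in> free_module (Suc i) \<and> lookup v i \<noteq> 0"
    by (auto simp: A_def)
  then obtain \<gamma> where \<gamma>: "\<And>i a. a \<in> A i \<Longrightarrow>
      \<gamma> i a \<in> M \<and> fine_homogeneous t a (\<gamma> i a) \<and> \<gamma> i a \<in> free_module (Suc i) \<and> lookup (\<gamma> i a) i \<noteq> 0"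
    by metis
  define G where "G = (\<Union>i<r. \<gamma> i ` B i)"
  have GM: "G \<subseteq> M" using \<gamma> B(2) unfolding G_def by blast
  have subM: "pm.subspace M" using M by (simp add: graded_submodule_def)
  have *: "v \<in> pm.span G"
    if "i \<le> r" "v \<in> M" "fine_homogeneous t a v" "v \<in> free_module i" for i v a
    using that
  proof (induction i arbitrary: v a)
    case 0
    then have "v = 0" by (intro poly_mapping_eqI) (simp add: free_module_iff)
    then show ?case by (simp add: pm.span_zero)
  next
    case (Suc i)
    show ?case
    proof (cases "lookup v i = 0")
      case True
      with Suc.prems(4) have "v \<in> free_module i" by (rule free_module_SucD)
      then show ?thesis using Suc.IH Suc.prems by simp
    next
      case False
      then have "a \<in> A i" using Suc.prems by (auto simp: A_def)
      then obtain b c where b: "b \<in> B i" "a = c + b" using B(3) by blast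
      then have bA: "b \<in> A i" using B(2) by blast
      note g = \<gamma>[OF bA]
      obtain m \<alpha> where m: "lookup v i = single m \<alpha>" "\<alpha> \<noteq> 0" "m + t i = a"
        using Suc.prems(3) False by (rule fine_homogeneous_lookup)
      obtain m' \<beta> where m': "lookup (\<gamma> i b) i = single m' \<beta>" "\<beta> \<noteq> 0" "m' + t i = b"
        using g by (blast elim: fine_homogeneous_lookup)
      have mm: "m = c + m'" using m(3) m'(3) b(2) by (metis add.assoc add_right_cancel)
      \<comment> \<open>Both \<open>i\<close>-th components are single terms whose exponents differ
        by \<open>c\<close>; the coefficient \<open>\<alpha> / \<beta>\<close> makes them cancel in
        \<open>v - u\<close>.\<close>
      define u where "u = pscale (single c (\<alpha> / \<beta>)) (\<gamma> i b)"
      have gG: "\<gamma> i b \<in> G" using b(1) Suc.prems(1) by (auto simp: G_def)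
      have uG: "u \<in> pm.span G" unfolding u_def by (intro pm.span_scale pm.span_base gG)
      have "fine_homogeneous t a u"
        unfolding u_def b(2) using g by (intro fine.homogeneous_pscale) (auto split: if_splits)
      moreover have "u \<in> free_module (Suc i)"
        unfolding u_def using g by (intro pm.subspace_scale subspace_free_module) auto
      moreover have "u \<in> M" unfolding u_def using g by (intro pm.subspace_scale subM) auto
      moreover have "lookup (v - u) i = 0"
        using m(1,2) m'(1,2) mm by (simp add: lookup_minus u_def mult_single)
      ultimately have "v - u \<in> M" "fine_homogeneous t a (v - u)" "v - u \<in> free_module i"
        using Suc.prems subM subspace_free_module
        by (blast intro: pm.subspace_diff homogeneous_diff free_module_SucD)+
      then have "v - u \<in> pm.span G" using Suc.IH Suc.prems by simp
      then show ?thesis using uG by (metis diff_add_cancel pm.span_add)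
    qed
  qed
  have "M = pm.span G"
  proof
    show "pm.span G \<subseteq> M" using GM subM by (rule pm.span_minimal)
    show "M \<subseteq> pm.span G"
    proof
      fix v assume v: "v \<in> M"
      then obtain D c where D: "\<forall>a\<in>D. c a \<in> M \<and> fine_homogeneous t a (c a)" "v = (\<Sum>a\<in>D. c a)"
        using M by (auto simp: graded_submodule_def)
      have "c a \<in> pm.span G" if "a \<in> D" for a
        using D(1) that M by (intro *[of r "c a" a]) (auto simp: graded_submodule_def)
      then show "v \<in> pm.span G" unfolding D(2) by (rule pm.span_sum)
    qed
  qed
  moreover have "finite G" using B(1) by (simp add: G_def)
  moreover have "\<exists>a. fine_homogeneous t a g" if "g \<in> G" for g
    using that \<gamma> B(2) unfolding G_def by blast
  ultimately show ?thesis using that GM by blast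
qed

lemma fine_cover:
  fixes M :: "('n::finite, 'k::field) fvec set"
  assumes M: "graded_submodule (\<lambda>m. m) r t M"
  shows "\<exists>b \<tau> f. fine_map b \<tau> t f \<and> f ` free_module b = M"
proof -
  obtain G where G: "finite G" "\<And>g. g \<in> G \<Longrightarrow> \<exists>a. fine_homogeneous t a g" "M = pm.span G"
    using fine_graded_finitely_generated[OF M] by metis
  obtain gs where gs: "set gs = G" using finite_list[OF G(1)] by blast
  obtain deg where deg: "\<And>g. g \<in> G \<Longrightarrow> fine_homogeneous t (deg g) g" using G(2) by metis
  let ?b = "length gs"
  let ?f = "lin_ext ?b (\<lambda>j. gs ! j)"
  have gen: "?f (single j 1) = gs ! j" if "j < ?b" for j
    using that by (simp add: lin_ext_single)
  have "fine_map ?b (\<lambda>j. deg (gs ! j)) t ?f"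
    using deg gs by (intro fine.graded_mapI is_linear_lin_ext) (auto simp: gen)
  moreover have "?f ` free_module ?b = M"
  proof
    show "?f ` free_module ?b \<subseteq> M"
    proof (unfold G(3), rule image_subsetI, rule lin_ext_mem[OF pm.subspace_span])
      show "gs ! j \<in> pm.span G" if "j < ?b" for j
        using that gs by (intro pm.span_base) auto
    qed
    have "G \<subseteq> ?f ` free_module ?b"
    proof
      fix g assume "g \<in> G"
      then obtain j where "j < ?b" "gs ! j = g" using gs by (metis in_set_conv_nth)
      then show "g \<in> ?f ` free_module ?b"
        using gen single_in_free_module[of j ?b] by (metis image_eqI)
    qed
    then show "M \<subseteq> ?f ` free_module ?b"
      unfolding G(3)
      by (intro pm.span_minimal module_hom.subspace_image[OF is_linear_lin_ext] subspace_free_module)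
  qed
  ultimately show ?thesis by blast
qed

text \<open>Since \<open>f\<close> commutes with taking components, the components of a kernel
  element stay in the kernel. Thus each syzygy module can be covered in its turn.\<close>

lemma graded_submodule_kernel:
  assumes f: "graded_map w b s s' f"
  shows "graded_submodule w b s {v \<in> free_module b. f v = 0}"
proof -
  note lin = graded_map_linear[OF f]
  have "pm.subspace {v \<in> free_module b. f v = 0}"
    using pm.subspace_inter[OF subspace_free_module module_hom.subspace_kernel[OF lin]]
    by (simp add: Collect_conj_eq)
  moreover have "\<exists>A c. finite A \<and>
      (\<forall>a\<in>A. c a \<in> {v \<in> free_module b. f v = 0} \<and> homogeneous w s a (c a)) \<and> v = (\<Sum>a\<in>A. c a)"
    if "v \<in> {v \<in> free_module b. f v = 0}" for v
  proof (intro exI conjI ballI)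
    show "finite (degrees_of w s v)" by (rule finite_degrees_of)
    show "v = (\<Sum>a\<in>degrees_of w s v. hcomp w s a v)" by (rule sum_hcomp[symmetric])
    fix a
    show "homogeneous w s a (hcomp w s a v)" by (rule homogeneous_hcomp)
    have "hcomp w s' a 0 = 0" by (rule fvec_eqI) (simp add: lookup_hcomp)
    then show "hcomp w s a v \<in> {v \<in> free_module b. f v = 0}"
      using that by (simp add: hcomp_in_free_module graded_map_hcomp[OF f])
  qed
  ultimately show ?thesis unfolding graded_submodule_def by blast
qed

lemma fine_resolution_exists:
  fixes M :: "('n::finite, 'k::field) fvec set"
  assumes M: "graded_submodule (\<lambda>m. m) r t M"
  obtains b \<tau> \<phi> where "fine_map (b 0) (\<tau> 0) t (\<phi> 0)" "\<phi> 0 ` free_module (b 0) = M"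
    "\<And>k. fine_map (b (Suc k)) (\<tau> (Suc k)) (\<tau> k) (\<phi> (Suc k))"
    "\<And>k. \<phi> (Suc k) ` free_module (b (Suc k)) = {v \<in> free_module (b k). \<phi> k v = 0}"
proof -
  \<comment> \<open>The target degrees change at every stage, so the invariant keeps what the next
    cover needs: the kernel is graded for the current basis degrees. The condition on
    \<open>M\<close> concerns the start alone.\<close>
  define P where "P k x \<longleftrightarrow> (case x of (b, \<tau>, \<phi>) \<Rightarrow>
      graded_submodule (\<lambda>m. m) b \<tau> {v \<in> free_module b. \<phi> v = 0} \<and>
      (k = 0 \<longrightarrow> fine_map b \<tau> t \<phi> \<and> \<phi> ` free_module b = M))"
    for k :: nat and x :: "nat \<times> (nat \<Rightarrow> 'n pp) \<times> (('n, 'k) fvec \<Rightarrow> ('n, 'k) fvec)"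
  define Q where "Q k x y \<longleftrightarrow> (case (x, y) of ((b, \<tau>, \<phi>), (b', \<tau>', \<phi>')) \<Rightarrow>
      fine_map b' \<tau>' \<tau> \<phi>' \<and> \<phi>' ` free_module b' = {v \<in> free_module b. \<phi> v = 0})"
    for k :: nat and x y :: "nat \<times> (nat \<Rightarrow> 'n pp) \<times> (('n, 'k) fvec \<Rightarrow> ('n, 'k) fvec)"
  have "\<exists>x. \<forall>k. P k (x k) \<and> Q k (x k) (x (Suc k))"
  proof (rule dependent_nat_choice)
    obtain b \<tau> \<phi> where "fine_map b \<tau> t \<phi>" "\<phi> ` free_module b = M"
      using fine_cover[OF M] by blast
    then have "P 0 (b, \<tau>, \<phi>)" by (simp add: P_def graded_submodule_kernel)
    then show "\<exists>x. P 0 x" by (rule exI)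
  next
    fix x k assume "P k x"
    obtain b \<tau> \<phi> where x: "x = (b, \<tau>, \<phi>)" by (cases x)
    then have "graded_submodule (\<lambda>m. m) b \<tau> {v \<in> free_module b. \<phi> v = 0}"
      using \<open>P k x\<close> by (simp add: P_def)
    from fine_cover[OF this] obtain b' \<tau>' \<phi>'
      where "fine_map b' \<tau>' \<tau> \<phi>'" "\<phi>' ` free_module b' = {v \<in> free_module b. \<phi> v = 0}" by blast
    then have "P (Suc k) (b', \<tau>', \<phi>') \<and> Q k x (b', \<tau>', \<phi>')"
      by (simp add: P_def Q_def x graded_submodule_kernel)
    then show "\<exists>y. P (Suc k) y \<and> Q k x y" by (rule exI)
  qed
  then obtain x where x: "\<And>k. P k (x k)" "\<And>k. Q k (x k) (x (Suc k))" by blast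
  show ?thesis
    by (rule that[of "\<lambda>k. fst (x k)" "\<lambda>k. fst (snd (x k))" "\<lambda>k. snd (snd (x k))"])
      (use x(1)[of 0] x(2) in \<open>simp_all add: P_def Q_def split_beta\<close>)
qed

section \<open>K-linear maps given on monomials, and independence of monomials\<close>

section \<open>Linear combinations indexed by power products\<close>

text \<open>For \<open>E = shifted_distr L s\<close> this is the distraction in a single component
  whose basis element has multidegree \<open>s\<close>.\<close>

definition lin_comb :: "('a \<Rightarrow> ('b \<Rightarrow>\<^sub>0 'k)) \<Rightarrow> ('a \<Rightarrow>\<^sub>0 'k::comm_ring_1) \<Rightarrow> ('b \<Rightarrow>\<^sub>0 'k)" where
  "lin_comb E p = (\<Sum>m\<in>keys p. pscale (lookup p m) (E m))"

lemma lin_comb_superset: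
  assumes "finite A" "keys p \<subseteq> A"
  shows "lin_comb E p = (\<Sum>m\<in>A. pscale (lookup p m) (E m))"
  unfolding lin_comb_def by (rule sum.mono_neutral_left) (use assms in \<open>auto simp: in_keys_iff\<close>)

lemma lin_comb_single: "lin_comb E (single m c) = pscale c (E m)"
  by (subst lin_comb_superset[of "{m}"]) simp_all

lemma is_linear_lin_comb:
  fixes E :: "'a \<Rightarrow> ('b \<Rightarrow>\<^sub>0 'k::comm_ring_1)"
  shows "is_linear (lin_comb E)"
  unfolding is_linear_iff
proof (intro conjI allI)
  fix u v :: "'a \<Rightarrow>\<^sub>0 'k" and c :: 'k
  have fin: "finite (keys u \<union> keys v)" by simp
  show "lin_comb E (u + v) = lin_comb E u + lin_comb E v"
    unfolding lin_comb_superset[OF fin keys_add] lin_comb_superset[OF fin Un_upper1]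
      lin_comb_superset[OF fin Un_upper2]
    by (simp add: lookup_add pm.scale_left_distrib sum.distrib)
  have "keys (pscale c v) \<subseteq> keys v" by (auto simp: in_keys_iff)
  then show "lin_comb E (pscale c v) = pscale c (lin_comb E v)"
    by (simp add: lin_comb_superset[of "keys v"] pm.scale_sum_right)
qed

lemma lin_comb_zero [simp]: "lin_comb E 0 = 0"
  by (simp add: lin_comb_def)

lemma sum_single_keys: "(\<Sum>m\<in>keys p. single m (lookup p m)) = p"
proof (rule poly_mapping_eqI)
  fix m
  have "lookup (\<Sum>m\<in>keys p. single m (lookup p m)) m = (\<Sum>m'\<in>keys p. if m' = m then lookup p m else 0)"
    unfolding lookup_sum by (rule sum.cong) (auto simp: lookup_single when_def)
  also have "\<dots> = lookup p m" by (auto simp: in_keys_iff)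
  finally show "lookup (\<Sum>m\<in>keys p. single m (lookup p m)) m = lookup p m" .
qed

lemma pscale_mult_left: "pscale a p * q = pscale a (p * (q :: ('n, 'k::comm_ring_1) mpoly))"
  by (simp add: pscale_def mult_map_scale_conv_mult mult.assoc)

lemma pscale_mult_right: "p * pscale a q = pscale a (p * (q :: ('n, 'k::comm_ring_1) mpoly))"
  by (metis mult.commute pscale_mult_left)

lemma lin_comb_mult:
  fixes q :: "('n, 'k::comm_ring_1) mpoly"
  shows "lin_comb E p * q = lin_comb (\<lambda>m. E m * q) p"
  by (simp add: lin_comb_def sum_distrib_right pscale_mult_left)

lemma finite_tdeg_eq: "finite {m :: 'n::finite pp. tdeg m = d}"
proof (rule inj_on_finite)
  show "inj_on lookup {m :: 'n pp. tdeg m = d}"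
    by (rule inj_onI, rule poly_mapping_eqI) simp
  have "lookup m x \<le> tdeg m" for m :: "'n pp" and x
    unfolding tdeg_def by (rule member_le_sum) auto
  then show "lookup ` {m :: 'n pp. tdeg m = d} \<subseteq> {f. \<forall>x. (x \<in> UNIV \<longrightarrow> f x \<in> {..d}) \<and> (x \<notin> UNIV \<longrightarrow> f x = 0)}"
    by auto
  show "finite {f :: 'n \<Rightarrow> nat. \<forall>x. (x \<in> UNIV \<longrightarrow> f x \<in> {..d}) \<and> (x \<notin> UNIV \<longrightarrow> f x = 0)}"
    by (rule finite_set_of_finite_funs) simp_all
qed

lemma independent_singles:
  "\<not> pm.dependent (range (\<lambda>m. single m 1 :: 'a \<Rightarrow>\<^sub>0 'k::field))" (is "\<not> pm.dependent ?R")
proof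
  assume "pm.dependent ?R"
  then obtain m :: 'a where m: "single m 1 \<in> pm.span (?R - {single m 1})"
    by (auto simp: pv.dependent_def)
  have "pm.subspace {p :: 'a \<Rightarrow>\<^sub>0 'k. lookup p m = 0}"
    by (rule pm.subspaceI) (simp_all add: lookup_add)
  moreover have "?R - {single m 1} \<subseteq> {p. lookup p m = 0}"
    by (auto simp: lookup_single when_def)
  ultimately have "single m 1 \<in> {p :: 'a \<Rightarrow>\<^sub>0 'k. lookup p m = 0}"
    using m pm.span_minimal by blast
  then show False by simp
qed

section \<open>Distracted monomials as a K-basis of the polynomial ring\<close>

section \<open>Distractions of power products\<close>

definition forms :: "nat \<Rightarrow> ('n::finite, 'k::zero) mpoly set" where
  "forms d = {p. \<forall>m\<in>keys p. tdeg m = d}"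

lemma forms_mult:
  assumes "p \<in> forms d" "q \<in> forms e"
  shows "p * q \<in> forms (d + e)"
  unfolding forms_def
proof (intro CollectI ballI)
  fix m assume "m \<in> keys (p * q)"
  then obtain m1 m2 where "m1 \<in> keys p" "m2 \<in> keys q" "m = m1 + m2"
    using keys_mult[of p q] by auto
  with assms show "tdeg m = d + e" by (simp add: forms_def tdeg_add)
qed

lemma forms_prod:
  fixes f :: "'i \<Rightarrow> ('n::finite, 'k::comm_ring_1) mpoly"
  shows "(\<And>i. i \<in> A \<Longrightarrow> f i \<in> forms (d i)) \<Longrightarrow> (\<Prod>i\<in>A. f i) \<in> forms (\<Sum>i\<in>A. d i)"
proof (induction A rule: infinite_finite_induct)
  case (insert i A)
  then show ?case using forms_mult[of "f i" "d i" "prod f A"] by simp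
qed (simp_all add: forms_def tdeg_zero)

text \<open>The quotient \<open>D\<^sub>L(s m) / D\<^sub>L(s)\<close>: the power product \<open>m\<close> distracted by the columns of \<open>L\<close>
  that come after those used by \<open>s\<close>.\<close>

definition shifted_distr ::
    "('n::finite \<Rightarrow> nat \<Rightarrow> ('n, 'k::field) mpoly) \<Rightarrow> 'n pp \<Rightarrow> 'n pp \<Rightarrow> ('n, 'k) mpoly" where
  "shifted_distr L s m = (\<Prod>i\<in>UNIV. \<Prod>j=1..lookup m i. L i (lookup s i + j))"

lemma shifted_distr_zero: "shifted_distr L s 0 = 1"
  by (simp add: shifted_distr_def)

text \<open>Cocycle rule: once the columns for \<open>m\<close> are used, those for
  \<open>m'\<close> start behind the ones counted by \<open>s + m\<close>. It takes the place of
  multiplicativity, which fails in general for a fixed shift.\<close>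

lemma shifted_distr_add:
  "shifted_distr L s (m + m') = shifted_distr L s m * shifted_distr L (s + m) m'"
proof -
  have "(\<Prod>j=1..a + b. f j) = (\<Prod>j=1..a. f j) * (\<Prod>j=1..b. f (a + j))"
    for a b and f :: "nat \<Rightarrow> ('a, 'b) mpoly"
    by (induction b) (simp_all add: mult.assoc)
  then show ?thesis
    by (simp add: shifted_distr_def lookup_add prod.distrib add.assoc)
qed

lemma distr_pp_eq_shifted_distr: "distr_pp L m = shifted_distr L 0 m"
  by (simp add: distr_pp_def shifted_distr_def)

lemma shifted_distr_variable:
  "shifted_distr L s (single i 1) = L i (Suc (lookup s i))"
proof -
  have "shifted_distr L s (single i 1) = (\<Prod>x\<in>UNIV. if x = i then L i (Suc (lookup s i)) else 1)"
    unfolding shifted_distr_def by (rule prod.cong) (auto simp: lookup_single when_def)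
  then show ?thesis by simp
qed

lemma pp_split_variable:
  fixes m :: "'n pp"
  assumes "m \<noteq> 0"
  obtains i m' where "m = m' + single i 1"
proof -
  obtain i where i: "lookup m i \<noteq> 0" using assms by (metis poly_mapping_eqI lookup_zero)
  have "m = (m - single i 1) + single i 1"
    using i by (intro poly_mapping_eqI) (auto simp: lookup_add lookup_minus lookup_single when_def)
  then show ?thesis by (rule that)
qed

lemma tdeg_single: "tdeg (single i c :: 'n::finite pp) = c"
  by (simp add: tdeg_def lookup_single when_def)

locale distr_matrix =
  fixes L :: "'n::finite \<Rightarrow> nat \<Rightarrow> ('n, 'k::field) mpoly"
  assumes L: "distraction_matrix L"
begin

lemma shifted_distr_forms: "shifted_distr L s m \<in> forms (tdeg m)"
proof -
  have "L i (lookup s i + j) \<in> forms 1" if "j \<in> {1..lookup m i}" for i j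
  proof -
    have "1 \<le> lookup s i + j" using that by simp
    with L have "L i (lookup s i + j) \<in> linear_forms" unfolding distraction_matrix_def by blast
    then show ?thesis by (simp add: linear_forms_def forms_def)
  qed
  then have "(\<Prod>j=1..lookup m i. L i (lookup s i + j)) \<in> forms (\<Sum>j=1..lookup m i. 1)" for i
    by (rule forms_prod)
  then show ?thesis
    unfolding shifted_distr_def tdeg_def by (intro forms_prod) simp
qed

lemma linear_form_mult_span:
  assumes l: "l \<in> linear_forms" and p: "p \<in> pm.span (shifted_distr L s ` {m. tdeg m = d})"
  shows "l * p \<in> pm.span (shifted_distr L s ` {m. tdeg m = Suc d})"
proof -
  let ?S = "pm.span (shifted_distr L s ` {m. tdeg m = Suc d})"
  have gen: "l * shifted_distr L s m \<in> ?S" if m: "tdeg m = d" for m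
  proof -
    have "L i (Suc (lookup (s + m) i)) * shifted_distr L s m \<in> ?S" for i
    proof -
      have "L i (Suc (lookup (s + m) i)) * shifted_distr L s m = shifted_distr L s (m + single i 1)"
        by (simp only: shifted_distr_add shifted_distr_variable mult.commute)
      moreover have "tdeg (m + single i 1) = Suc d" using m by (simp add: tdeg_add tdeg_single)
      ultimately show ?thesis by (auto intro: pm.span_base)
    qed
    moreover have "pm.subspace {q. q * shifted_distr L s m \<in> ?S}"
      by (rule pm.subspaceI)
        (simp_all add: pm.span_zero distrib_right pm.span_add pscale_mult_left pm.span_scale)
    ultimately have "pm.span ((\<lambda>i. L i (Suc (lookup (s + m) i))) ` UNIV) \<subseteq> {q. q * shifted_distr L s m \<in> ?S}"
      by (intro pm.span_minimal) auto
    moreover have "pm.span ((\<lambda>i. L i (Suc (lookup (s + m) i))) ` UNIV) = linear_forms"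
      using L unfolding distraction_matrix_def by (metis One_nat_def Suc_leI zero_less_Suc)
    ultimately show ?thesis using l by auto
  qed
  have "pm.subspace {q. l * q \<in> ?S}"
    by (rule pm.subspaceI)
      (simp_all add: pm.span_zero distrib_left pm.span_add pscale_mult_right pm.span_scale)
  then have "pm.span (shifted_distr L s ` {m. tdeg m = d}) \<subseteq> {q. l * q \<in> ?S}"
    using gen by (intro pm.span_minimal) auto
  then show ?thesis using p by auto
qed

lemma single_in_span_shifted_distr:
  "tdeg m = d \<Longrightarrow> single m 1 \<in> pm.span (shifted_distr L s ` {m. tdeg m = d})"
proof (induction d arbitrary: m)
  case 0
  then have "m = 0" by (intro poly_mapping_eqI) (simp add: tdeg_def)
  then have "single m 1 = shifted_distr L s 0" by (simp add: shifted_distr_zero)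
  then show ?case by (auto intro: pm.span_base simp: tdeg_zero)
next
  case (Suc d)
  then have "m \<noteq> 0" by (auto simp: tdeg_zero)
  then obtain i m' where m: "m = m' + single i 1" by (rule pp_split_variable)
  then have "tdeg m' = d" using Suc.prems by (simp add: tdeg_add tdeg_single)
  then have "single (single i 1) 1 * single m' 1 \<in> pm.span (shifted_distr L s ` {m. tdeg m = Suc d})"
    by (intro linear_form_mult_span Suc.IH) (simp_all add: linear_forms_def tdeg_single)
  then show ?case by (simp add: m mult_single add.commute)
qed

lemma lin_comb_shifted_distr_surj: "\<exists>c. lin_comb (shifted_distr L s) c = p"
proof -
  interpret module_hom pscale pscale "lin_comb (shifted_distr L s)" by (rule is_linear_lin_comb)
  have sub: "pm.subspace (range (lin_comb (shifted_distr L s)))"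
    by (rule subspace_image) simp
  have "shifted_distr L s m \<in> range (lin_comb (shifted_distr L s))" for m
    by (rule range_eqI[of _ _ "single m 1"]) (simp add: lin_comb_single)
  then have "pm.span (shifted_distr L s ` A) \<subseteq> range (lin_comb (shifted_distr L s))" for A
    by (intro pm.span_minimal sub) auto
  then have "single m 1 \<in> range (lin_comb (shifted_distr L s))" for m
    using single_in_span_shifted_distr[OF refl, of m s] by blast
  then have "pscale (lookup p m) (single m 1) \<in> range (lin_comb (shifted_distr L s))" for m
    using sub by (rule pm.subspace_scale[rotated])
  moreover have "pscale c (single m 1) = single m c" for c :: 'k and m :: "'n pp"
    by (rule poly_mapping_eqI) (simp add: lookup_single when_def)
  ultimately have "(\<Sum>m\<in>keys p. single m (lookup p m)) \<in> range (lin_comb (shifted_distr L s))"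
    by (intro pm.subspace_sum[OF sub]) metis
  then show ?thesis unfolding sum_single_keys by auto
qed

text \<open>The products of degree \<open>d\<close> span the forms of degree \<open>d\<close> and are as many as the monomials of
  degree \<open>d\<close>, so they satisfy no linear relation.\<close>

lemma lin_comb_shifted_distr_inj:
  assumes "lin_comb (shifted_distr L s) p = 0"
  shows "p = 0"
proof (rule ccontr)
  assume "p \<noteq> 0"
  then obtain m where m: "lookup p m \<noteq> 0" by (metis poly_mapping_eqI lookup_zero)
  define E where "E = shifted_distr L s"
  define N where "N = {m' :: 'n pp. tdeg m' = tdeg m}"
  have fin: "finite N" unfolding N_def by (rule finite_tdeg_eq)
  have mN: "m \<in> N" by (simp add: N_def)
  have E_lookup: "lookup (E m') x = 0" if "tdeg x \<noteq> tdeg m'" for m' x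
    using shifted_distr_forms[of s m'] that by (auto simp: E_def forms_def in_keys_iff)
  \<comment> \<open>\<open>p\<close> may mix degrees. As each \<open>E m'\<close> is a form of
    degree \<open>tdeg m'\<close>, the part of the relation in degree \<open>tdeg m\<close> is
    itself a relation.\<close>
  have rel: "(\<Sum>m'\<in>N. pscale (lookup p m') (E m')) = 0"
  proof (rule poly_mapping_eqI)
    fix x
    show "lookup (\<Sum>m'\<in>N. pscale (lookup p m') (E m')) x = lookup 0 x"
    proof (cases "tdeg x = tdeg m")
      case True
      have "lookup (\<Sum>m'\<in>N. pscale (lookup p m') (E m')) x
          = (\<Sum>m'\<in>keys p \<union> N. lookup p m' * lookup (E m') x)"
        unfolding lookup_sum lookup_pscale
        by (rule sum.mono_neutral_left) (auto simp: finite_tdeg_eq N_def E_lookup True)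
      also have "\<dots> = lookup (lin_comb E p) x"
        by (simp add: lin_comb_superset[of "keys p \<union> N"] fin lookup_sum)
      finally show ?thesis using assms by (simp add: E_def)
    next
      case False
      then show ?thesis by (auto simp: lookup_sum N_def E_lookup)
    qed
  qed
  have "pscale (lookup p m) (E m) = - (\<Sum>m'\<in>N - {m}. pscale (lookup p m') (E m'))"
    using rel sum.remove[OF fin mN, of "\<lambda>m'. pscale (lookup p m') (E m')"] by (simp add: eq_neg_iff_add_eq_0)
  also have "\<dots> \<in> pm.span (E ` (N - {m}))"
    by (intro pm.span_neg pm.span_sum pm.span_scale pm.span_base) auto
  finally have "pscale (inverse (lookup p m)) (pscale (lookup p m) (E m)) \<in> pm.span (E ` (N - {m}))"
    by (rule pm.span_scale)
  then have Em: "E m \<in> pm.span (E ` (N - {m}))" using m by simp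
  have "E ` N \<subseteq> pm.span (E ` (N - {m}))"
  proof
    fix y assume "y \<in> E ` N"
    then show "y \<in> pm.span (E ` (N - {m}))"
      using Em by (cases "y = E m") (auto intro: pm.span_base)
  qed
  then have "pm.span (E ` N) \<subseteq> pm.span (E ` (N - {m}))"
    by (intro pm.span_minimal pm.subspace_span)
  moreover have "(\<lambda>m'. single m' 1) ` N \<subseteq> pm.span (E ` N)"
    using single_in_span_shifted_distr[of _ "tdeg m" s] by (auto simp: E_def N_def)
  ultimately have sub: "(\<lambda>m'. single m' 1) ` N \<subseteq> pm.span (E ` (N - {m}))" by (rule subset_trans[rotated])
  have "\<not> pm.dependent ((\<lambda>m'. single m' (1 :: 'k)) ` N)"
    by (rule pm.independent_mono[OF independent_singles]) auto
  \<comment> \<open>Exchange bound: the relation makes \<open>E m\<close> redundant, so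
    \<open>card N\<close> independent monomials would lie in the span of fewer vectors.\<close>
  from pv.independent_span_bound[OF _ this sub] fin
  have "card ((\<lambda>m'. single m' (1 :: 'k)) ` N) \<le> card (E ` (N - {m}))" by simp
  also have "\<dots> \<le> card (N - {m})" using fin by (intro card_image_le) simp
  also have "\<dots> < card N" using fin mN by (rule card_Diff1_less)
  also have "card N = card ((\<lambda>m'. single m' (1 :: 'k)) ` N)"
    by (rule card_image[symmetric]) (auto intro!: inj_onI dest: arg_cong[where f = keys])
  finally show False by simp
qed

text \<open>Multiplication by \<open>D\<^sub>L(s)\<close> sends the basis \<open>D\<^sub>L(s m) / D\<^sub>L(s)\<close> of the polynomial ring to
  the linearly independent family \<open>D\<^sub>L(s m)\<close>.\<close>

lemma distr_pp_cancel:
  assumes "p * distr_pp L s = 0"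
  shows "p = 0"
proof -
  obtain c where c: "lin_comb (shifted_distr L s) c = p"
    using lin_comb_shifted_distr_surj by blast
  interpret module_hom pscale pscale "lin_comb (shifted_distr L 0)" by (rule is_linear_lin_comb)
  \<comment> \<open>The coefficients of \<open>p\<close> in the basis shifted by \<open>s\<close>
    are moved to the exponents \<open>s + m\<close> of the unshifted one.\<close>
  define c' where "c' = (\<Sum>m\<in>keys c. single (s + m) (lookup c m))"
  have "lin_comb (shifted_distr L 0) c' = p * distr_pp L s"
    unfolding c'_def c[symmetric] lin_comb_mult lin_comb_def[of "\<lambda>m. _ m * _"]
    by (simp add: sum lin_comb_single distr_pp_eq_shifted_distr shifted_distr_add[of L 0] mult.commute)
  then have "c' = 0" using assms lin_comb_shifted_distr_inj by simp
  moreover have "lookup c' (s + m) = lookup c m" for m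
  proof -
    have "lookup c' (s + m) = (\<Sum>m'\<in>keys c. if m' = m then lookup c m else 0)"
      unfolding c'_def lookup_sum by (rule sum.cong) (auto simp: lookup_single when_def)
    then show ?thesis by (auto simp: in_keys_iff)
  qed
  ultimately have "c = 0" by (metis poly_mapping_eqI lookup_zero)
  then show ?thesis using c by simp
qed

text \<open>\<open>distr_quot\<close> is a definite description, so existence of the quotient must
  be joined by uniqueness; the latter is cancellation of \<open>distr_pp L s\<close>.\<close>

lemma distr_quot_eq_shifted_distr: "distr_quot L s m = shifted_distr L s m"
proof -
  have eq: "distr_pp L (m + s) = shifted_distr L s m * distr_pp L s"
    by (simp add: distr_pp_eq_shifted_distr add.commute[of m] shifted_distr_add[of L 0] mult.commute)
  show ?thesis
    unfolding distr_quot_def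
  proof (rule the_equality)
    show "distr_pp L (m + s) = shifted_distr L s m * distr_pp L s" by (rule eq)
  next
    fix q assume "distr_pp L (m + s) = q * distr_pp L s"
    then have "(q - shifted_distr L s m) * distr_pp L s = 0" by (simp add: eq left_diff_distrib)
    then show "q = shifted_distr L s m" using distr_pp_cancel by force
  qed
qed

section \<open>Transport of a multigraded resolution by the distraction\<close>

section \<open>Distractions of free modules\<close>

abbreviation D :: "(nat \<Rightarrow> 'n pp) \<Rightarrow> ('n, 'k) fvec \<Rightarrow> ('n, 'k) fvec" where
  "D \<equiv> distraction L"

lemma lookup_distraction: "lookup (D t v) i = lin_comb (shifted_distr L (t i)) (lookup v i)"
proof -
  have "lookup (D t v) i = (\<Sum>j\<in>keys v. if j = i then lin_comb (shifted_distr L (t i)) (lookup v i) else 0)"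
    unfolding distraction_def distr_quot_eq_shifted_distr lin_comb_def[symmetric] lookup_sum
    by (rule sum.cong) (auto simp: lookup_single when_def)
  then show ?thesis by (auto simp: in_keys_iff)
qed

lemma distraction_add: "D t (u + v) = D t u + D t v"
  by (rule poly_mapping_eqI)
    (simp add: lookup_distraction lookup_add module_hom.add[OF is_linear_lin_comb])

lemma distraction_zero: "D t 0 = 0"
  by (rule poly_mapping_eqI) (simp add: lookup_distraction)

lemma distraction_sum: "D t (\<Sum>j\<in>A. f j) = (\<Sum>j\<in>A. D t (f j))"
  by (induction A rule: infinite_finite_induct) (simp_all add: distraction_zero distraction_add)

lemma distraction_eq_0D:
  assumes "D t v = 0"
  shows "v = 0"
proof (rule poly_mapping_eqI)
  fix i
  have "lin_comb (shifted_distr L (t i)) (lookup v i) = 0"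
    using assms lookup_distraction[of t v i] by simp
  then show "lookup v i = lookup 0 i" by (simp add: lin_comb_shifted_distr_inj)
qed

lemma distraction_image_free_module: "D t ` free_module b = free_module b"
proof
  show "D t ` free_module b \<subseteq> free_module b"
    by (auto simp: free_module_iff lookup_distraction)
  show "free_module b \<subseteq> D t ` free_module b"
  proof
    fix u :: "('n, 'k) fvec" assume u: "u \<in> free_module b"
    have "\<forall>i. \<exists>c. lin_comb (shifted_distr L (t i)) c = lookup u i"
      using lin_comb_shifted_distr_surj by blast
    then obtain c where c: "\<And>i. lin_comb (shifted_distr L (t i)) (c i) = lookup u i" by metis
    define v where "v = (\<Sum>i<b. single i (c i))"
    have v: "lookup v i = (if i < b then c i else 0)" for i
    proof -
      have "lookup v i = (\<Sum>j<b. if j = i then c i else 0)"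
        unfolding v_def lookup_sum by (rule sum.cong) (auto simp: lookup_single when_def)
      then show ?thesis by simp
    qed
    have "D t v = u"
      using u by (intro poly_mapping_eqI) (auto simp: lookup_distraction v c free_module_iff)
    moreover have "v \<in> free_module b" by (simp add: free_module_iff v)
    ultimately show "u \<in> D t ` free_module b" by blast
  qed
qed

lemma distraction_std_homogeneous:
  assumes "std_homogeneous (\<lambda>i. int (tdeg (t i))) a v"
  shows "std_homogeneous (\<lambda>i. int (tdeg (t i))) a (D t v)"
  unfolding homogeneous_def
proof (intro allI ballI)
  fix i m assume "m \<in> keys (lookup (D t v) i)"
  then have "(\<Sum>m'\<in>keys (lookup v i). lookup (lookup v i) m' * lookup (shifted_distr L (t i) m') m) \<noteq> 0"
    by (simp add: in_keys_iff lookup_distraction lin_comb_def lookup_sum)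
  then obtain m' where m': "m' \<in> keys (lookup v i)" "lookup (shifted_distr L (t i) m') m \<noteq> 0"
    by (metis (no_types, lifting) sum.neutral mult_zero_right)
  then have "tdeg m = tdeg m'"
    using shifted_distr_forms[of "t i" m'] by (auto simp: forms_def in_keys_iff)
  with m'(1) assms show "int (tdeg m) + int (tdeg (t i)) = a" by (auto simp: homogeneous_def)
qed

text \<open>The factor attached to \<open>m\<close> is a form of degree \<open>tdeg m\<close>: it is
  1 for \<open>m = 0\<close> and has no constant term otherwise.\<close>

lemma distraction_constant_terms: "lookup (lookup (D t v) i) 0 = lookup (lookup v i) 0"
proof -
  have E: "lookup (shifted_distr L s m) 0 = (if m = 0 then 1 else 0)" for s m
  proof (cases "m = 0")
    case False
    then have "tdeg m \<noteq> 0" by (auto simp: tdeg_def poly_mapping_eq_iff fun_eq_iff)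
    then show ?thesis
      using shifted_distr_forms[of s m] False tdeg_zero[where ?'a = 'n] by (force simp: forms_def in_keys_iff)
  qed (simp add: shifted_distr_zero)
  have "lookup (lookup (D t v) i) 0 = (\<Sum>m\<in>keys (lookup v i). if m = 0 then lookup (lookup v i) 0 else 0)"
    unfolding lookup_distraction lin_comb_def lookup_sum by (rule sum.cong) (auto simp: E)
  then show ?thesis by (auto simp: in_keys_iff)
qed

text \<open>A nonzero component \<open>i\<close> of \<open>u\<close> is a term with exponent
  \<open>m'\<close> satisfying \<open>m' + t i = a\<close>. Multiplying it by \<open>m\<close> uses
  the columns behind those counted by \<open>a\<close>, whatever \<open>i\<close> is, so the factor
  is the same in all components.\<close>

lemma distraction_pscale:
  assumes u: "fine_homogeneous t a u"
  shows "D t (pscale p u) = pscale (lin_comb (shifted_distr L a) p) (D t u)"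
proof -
  have monom: "D t (pscale (single m c) u) = pscale (pscale c (shifted_distr L a m)) (D t u)" for m c
  proof (rule poly_mapping_eqI)
    fix i
    show "lookup (D t (pscale (single m c) u)) i = lookup (pscale (pscale c (shifted_distr L a m)) (D t u)) i"
    proof (cases "lookup u i = 0")
      case False
      obtain m' \<alpha> where m': "lookup u i = single m' \<alpha>" "m' + t i = a"
        using u False by (rule fine_homogeneous_lookup)
      have "shifted_distr L (t i) (m + m') = shifted_distr L a m * shifted_distr L (t i) m'"
        unfolding add.commute[of m m'] shifted_distr_add using m'(2) by (simp add: add.commute mult.commute)
      then show ?thesis
        by (simp add: lookup_distraction m'(1) mult_single lin_comb_single pscale_mult_left pscale_mult_right)
    qed (simp add: lookup_distraction)
  qed
  have "D t (pscale p u) = D t (pscale (\<Sum>m\<in>keys p. single m (lookup p m)) u)"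
    by (simp add: sum_single_keys)
  also have "\<dots> = pscale (lin_comb (shifted_distr L a) p) (D t u)"
    by (simp add: pm.scale_sum_left distraction_sum monom lin_comb_def)
  finally show ?thesis .
qed

text \<open>\<open>D\<close> fixes the basis elements, so these are the values that the conjugate of
  \<open>f\<close> takes there. Extending them linearly over P gives linearity by construction, and
  agreement with the conjugate becomes the statement to prove.\<close>

definition distraction_map ::
    "nat \<Rightarrow> (nat \<Rightarrow> 'n pp) \<Rightarrow> (('n, 'k) fvec \<Rightarrow> ('n, 'k) fvec) \<Rightarrow> ('n, 'k) fvec \<Rightarrow> ('n, 'k) fvec" where
  "distraction_map b t f = lin_ext b (\<lambda>j. D t (f (single j 1)))"

text \<open>Multihomogeneity of \<open>f\<close> makes the conjugate of \<open>f\<close> by the \<open>K\<close>-linear bijections \<open>D\<close> a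
  \<open>P\<close>-linear map.\<close>

lemma distraction_map_commute:
  assumes f: "fine_map b \<tau> t f" and v: "v \<in> free_module b"
  shows "distraction_map b t f (D \<tau> v) = D t (f v)"
proof -
  \<comment> \<open>The image of basis element \<open>j\<close> has multidegree
    \<open>\<tau> j\<close>, so the multiplier produced is exactly component \<open>j\<close> of
    \<open>D \<tau> v\<close>.\<close>
  have "D t (pscale (lookup v j) (f (single j 1)))
      = pscale (lin_comb (shifted_distr L (\<tau> j)) (lookup v j)) (D t (f (single j 1)))" if "j < b" for j
    by (rule distraction_pscale,
        rule graded_map_homogeneous[OF f single_in_free_module[OF that] fine.homogeneous_single])
  then show ?thesis
    unfolding is_linear_eq_lin_ext[OF graded_map_linear[OF f] v] distraction_map_def lin_ext_def
    by (simp add: distraction_sum lookup_distraction)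
qed

lemma fine_map_imp_std_map:
  assumes f: "fine_map b \<tau> t f"
  shows "std_map b (\<lambda>j. int (tdeg (\<tau> j))) (\<lambda>j. int (tdeg (t j))) f"
    and "std_map b (\<lambda>j. int (tdeg (\<tau> j))) (\<lambda>j. int (tdeg (t j))) (distraction_map b t f)"
proof -
  have h: "std_homogeneous (\<lambda>j. int (tdeg (t j))) (int (tdeg (\<tau> j))) (f (single j 1))" if "j < b" for j
  proof -
    have "fine_homogeneous t (\<tau> j) (f (single j 1))"
      by (rule graded_map_homogeneous[OF f single_in_free_module[OF that] fine.homogeneous_single])
    then show ?thesis by (auto simp: homogeneous_def tdeg_add[symmetric] simp flip: of_nat_add)
  qed
  then show "std_map b (\<lambda>j. int (tdeg (\<tau> j))) (\<lambda>j. int (tdeg (t j))) f"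
    by (intro std.graded_mapI graded_map_linear[OF f])
  show "std_map b (\<lambda>j. int (tdeg (\<tau> j))) (\<lambda>j. int (tdeg (t j))) (distraction_map b t f)"
    unfolding distraction_map_def
    by (intro std.graded_mapI is_linear_lin_ext) (simp add: lin_ext_single distraction_std_homogeneous h)
qed

lemma distraction_map_image:
  assumes "fine_map b \<tau> t f"
  shows "distraction_map b t f ` free_module b = D t ` f ` free_module b"
proof -
  have "distraction_map b t f ` free_module b = (\<lambda>v. distraction_map b t f (D \<tau> v)) ` free_module b"
    by (simp only: distraction_image_free_module image_image[symmetric])
  also have "\<dots> = (\<lambda>v. D t (f v)) ` free_module b"
    by (rule image_cong) (simp_all add: distraction_map_commute[OF assms])
  finally show ?thesis by (simp add: image_image)
qed

text \<open>\<open>D \<tau>\<close> maps the free module onto itself and \<open>D t\<close> is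
  injective, so vanishing can be tested before distraction.\<close>

lemma distraction_map_kernel:
  assumes "fine_map b \<tau> t f"
  shows "{v \<in> free_module b. distraction_map b t f v = 0} = D \<tau> ` {v \<in> free_module b. f v = 0}"
proof -
  have "distraction_map b t f (D \<tau> v) = 0 \<longleftrightarrow> f v = 0" if "v \<in> free_module b" for v
    using distraction_map_commute[OF assms that] distraction_eq_0D[of t "f v"] distraction_zero[of t]
    by auto
  then have "{v \<in> D \<tau> ` free_module b. distraction_map b t f v = 0} = D \<tau> ` {v \<in> free_module b. f v = 0}"
    by auto
  then show ?thesis by (simp add: distraction_image_free_module)
qed

lemma tensor_map_distraction_map:
  assumes "is_linear f" "c \<in> tensor_component b \<delta> d"
  shows "tensor_map (distraction_map b t f) c = tensor_map f c"
proof (rule poly_mapping_eqI)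
  fix i
  have c: "c \<in> free_module b" using assms(2) tensor_component_subset by blast
  show "lookup (tensor_map (distraction_map b t f) c) i = lookup (tensor_map f c) i"
    unfolding distraction_map_def lookup_tensor_map[OF assms(1) c]
      lookup_tensor_map[OF is_linear_lin_ext c]
    by (simp add: lin_ext_single distraction_constant_terms)
qed

theorem betti_distraction:
  assumes M: "graded_submodule (\<lambda>m. m) r t M"
  shows "betti (\<lambda>i. int (tdeg (t i))) M k d = betti (\<lambda>i. int (tdeg (t i))) (D t ` M) k d"
proof -
  obtain b \<tau> \<phi> where \<phi>: "fine_map (b 0) (\<tau> 0) t (\<phi> 0)" "\<phi> 0 ` free_module (b 0) = M"
    "\<And>k. fine_map (b (Suc k)) (\<tau> (Suc k)) (\<tau> k) (\<phi> (Suc k))"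
    "\<And>k. \<phi> (Suc k) ` free_module (b (Suc k)) = {v \<in> free_module (b k). \<phi> k v = 0}"
    by (rule fine_resolution_exists[OF M], rule that)
  define \<delta> where "\<delta> k j = int (tdeg (\<tau> k j))" for k j
  \<comment> \<open>The basis degrees of the target of \<open>\<phi> k\<close>: the ambient module
    for the augmentation, the preceding free module otherwise.\<close>
  define t' where "t' k = (case k of 0 \<Rightarrow> t | Suc k \<Rightarrow> \<tau> k)" for k
  define \<psi> where "\<psi> k = distraction_map (b k) (t' k) (\<phi> k)" for k
  have fine: "fine_map (b k) (\<tau> k) (t' k) (\<phi> k)" for k
    using \<phi> by (cases k) (simp_all add: t'_def)
  note std = fine_map_imp_std_map[OF fine]
  have R: "graded_free_resolution (\<lambda>i. int (tdeg (t i))) M b \<delta> \<phi>"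
    unfolding graded_free_resolution_iff \<delta>_def
    using \<phi> std(1)[of 0] std(1)[of "Suc _"] by (simp add: t'_def)
  \<comment> \<open>Exactness carries over: both sides are the image under
    \<open>D (\<tau> k)\<close> of the kernel of \<open>\<phi> k\<close>.\<close>
  have "\<psi> (Suc k) ` free_module (b (Suc k)) = {v \<in> free_module (b k). \<psi> k v = 0}" for k
    unfolding \<psi>_def distraction_map_kernel[OF fine] distraction_map_image[OF fine] \<phi>(4)
    by (simp add: t'_def)
  moreover have "\<psi> 0 ` free_module (b 0) = D t ` M"
    unfolding \<psi>_def distraction_map_image[OF fine] \<phi>(2) by (simp add: t'_def)
  ultimately have R': "graded_free_resolution (\<lambda>i. int (tdeg (t i))) (D t ` M) b \<delta> \<psi>"
    unfolding graded_free_resolution_iff \<delta>_def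
    using std(2)[of 0] std(2)[of "Suc _"] by (simp add: t'_def \<psi>_def)
  have tensor: "tensor_map (\<psi> k) c = tensor_map (\<phi> k) c" if "c \<in> tensor_component (b k) (\<delta> k) d" for k c
    unfolding \<psi>_def by (rule tensor_map_distraction_map[OF graded_map_linear[OF fine] that])
  have "{c \<in> tensor_component (b k) (\<delta> k) d. k = 0 \<or> tensor_map (\<phi> k) c = 0}
      = {c \<in> tensor_component (b k) (\<delta> k) d. k = 0 \<or> tensor_map (\<psi> k) c = 0}"
    using tensor by auto
  moreover have "tensor_map (\<phi> (Suc k)) ` tensor_component (b (Suc k)) (\<delta> (Suc k)) d
      = tensor_map (\<psi> (Suc k)) ` tensor_component (b (Suc k)) (\<delta> (Suc k)) d"
    by (rule image_cong) (simp_all add: tensor)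
  ultimately have "tor_dim b \<delta> \<phi> k d = tor_dim b \<delta> \<psi> k d"
    unfolding tor_dim_def by simp
  then show ?thesis by (simp add: betti_eq_tor_dim[OF R] betti_eq_tor_dim[OF R'])
qed

end

theorem corollary2p20:
  fixes L :: "'n::finite \<Rightarrow> nat \<Rightarrow> ('n, 'k::field) mpoly"
    and r :: nat
    and t :: "nat \<Rightarrow> 'n pp"
    and M :: "('n, 'k) fvec set"
  assumes "infinite (UNIV :: 'k set)"
    and "distraction_matrix L"
    and "graded_submodule (\<lambda>m. m) r t M"
  shows "\<forall>k d. betti (\<lambda>i. int (tdeg (t i))) M k d =
               betti (\<lambda>i. int (tdeg (t i))) (distraction L t ` M) k d"
  using distr_matrix.betti_distraction[OF distr_matrix.intro[OF assms(2)] assms(3)] by blast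

end
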